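(* Let $A$ be an alphabet, let $F\subseteq A^*$ be a uniformly recurrent language over $A$, and let $X$ be a finite $F$-complete $F$-charged code contained in $F$ (so $X=Z\cap F$ for some $F$-charged rational complete bifix code $Z\subseteq A^+$). Then $F\cap X^*$, viewed as a language over the alphabet $X$, is uniformly recurrent over $X$. (That is: every charged complete bifix decoding of a uniformly recurrent language is uniformly recurrent.)
   Context: Alphabets are nonempty finite sets; $A^*$ is the free monoid on $A$ and $A^+$ the set of nonempty words. A language $F\subseteq A^*$ is factorial if closed under taking factors, prolongable if for every $u\in F$ there are $a,b\in A$ with $au,ub\in F$, and a subshift language if it is nonempty, factorial and prolongable. A subshift language $F$ is recurrent (over $A$) if for all $u,v\in F$ there is $w\in F$ with $uwv\in F$; it is uniformly recurrent (over $A$) if for every $u\in F$ there is an integer $N$ such that $u$ is a factor of every word of $F$ of length at least $N$. $\widehat{A^*}$ is the free profinite monoid generated by $A$ ($A^*$ embeds densely in it); $\overline{L}$ is the closure in $\widehat{A^*}$ of a set $L$. In a monoid $M$, $x\leq_{\mathcal J}y$ iff $x\in MyM$; $x\leq_{\mathcal R}y$ iff $x\in yM$; $x\leq_{\mathcal L}y$ iff $x\in My$; $\mathcal J,\mathcal R,\mathcal L$ are the induced equivalences and $\mathcal H=\mathcal R\cap\mathcal L$. The maximal subgroups of $M$ are the $\mathcal H$-classes containing an idempotent. $J_A(F)$ is the set of $\leq_{\mathcal J}$-minimal elements (in the monoid $\widehat{A^*}$) of $\overline F$; if $F$ is recurrent it is a single regular $\mathcal J$-class. A code over $A$ is a nonempty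 subset of $A^+$ freely generating a submonoid of $A^*$; it is bifix if no element is a proper prefix or a proper suffix of another element. A code $Z\subseteq A^+$ is complete if every word of $A^*$ is a prefix of an element of $Z^*$ and a suffix of an element of $Z^*$. A code $X\subseteq F$ is $F$-complete if every word of $F$ is a prefix of an element of $X^*$ and a suffix of an element of $X^*$. For a rational language $L\subseteq A^*$, $\hat\eta_L\colon\widehat{A^*}\to M(L)$ is the continuous extension of the syntactic homomorphism of $L$ onto its (finite) syntactic monoid $M(L)$. For $F$ recurrent, a rational complete bifix code $Z\subseteq A^+$ is $F$-charged if for every maximal subgroup $K\subseteq J_A(F)$ the image $\hat\eta_{Z^*}(K)$ is a maximal subgroup of $M(Z^* )$ contained in the minimum ideal of $M(Z^* )$. A rational code $X$ is $F$-complete $F$-charged if it is $F$-complete and $X=Z\cap F$ for some $F$-charged rational complete bifix code $Z\subseteq A^+$. Since $X$ is a code, $X^*$ is the free monoid on the alphabet $X$, and $F\cap X^*$ is regarded as a language over the alphabet $X$ (factors, lengths, etc. being taken in the free monoid on $X$). *)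

theory Defs
  imports "HOL-Analysis.Function_Topology" "HOL-Analysis.T1_Spaces" "HOL-Algebra.Group"
    "HOL-Library.Sublist"
begin

section \<open>Languages\<close>

text \<open>Words over an alphabet \<open>A\<close> are the elements of \<^term>\<open>lists A\<close>; the factor relation on words
  is \<^const>\<open>sublist\<close>. Alphabets are explicit sets, so that a code over \<open>A\<close>, a set of
  words, can itself serve as an alphabet.\<close>

definition subshift_language :: "'a set \<Rightarrow> 'a list set \<Rightarrow> bool" where
  "subshift_language A F \<longleftrightarrow>
     F \<subseteq> lists A \<and> F \<noteq> {} \<and>
     (\<forall>w\<in>F. \<forall>u. sublist u w \<longrightarrow> u \<in> F) \<and>
     (\<forall>u\<in>F. \<exists>a\<in>A. \<exists>b\<in>A. a # u \<in> F \<and> u @ [b] \<in> F)"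

definition recurrent :: "'a set \<Rightarrow> 'a list set \<Rightarrow> bool" where
  "recurrent A F \<longleftrightarrow>
     subshift_language A F \<and> (\<forall>u\<in>F. \<forall>v\<in>F. \<exists>w\<in>F. u @ w @ v \<in> F)"

definition uniformly_recurrent :: "'a set \<Rightarrow> 'a list set \<Rightarrow> bool" where
  "uniformly_recurrent A F \<longleftrightarrow>
     subshift_language A F \<and> (\<forall>u\<in>F. \<exists>N. \<forall>w\<in>F. N \<le> length w \<longrightarrow> sublist u w)"

definition generated_submonoid :: "'a list set \<Rightarrow> 'a list set" where
  "generated_submonoid X = concat ` lists X"

inductive rational :: "'a set \<Rightarrow> 'a list set \<Rightarrow> bool" for A where
  finite: "finite L \<Longrightarrow> L \<subseteq> lists A \<Longrightarrow> rational A L"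
| union: "rational A K \<Longrightarrow> rational A L \<Longrightarrow> rational A (K \<union> L)"
| product: "rational A K \<Longrightarrow> rational A L \<Longrightarrow> rational A {u @ v | u v. u \<in> K \<and> v \<in> L}"
| star: "rational A L \<Longrightarrow> rational A (generated_submonoid L)"

section \<open>Codes\<close>

text \<open>The homomorphism from the free monoid on the alphabet \<open>X\<close> to the free monoid on \<open>A\<close> that
  extends the inclusion is \<^const>\<open>concat\<close> on \<^term>\<open>lists X\<close>; \<open>X\<close> generates freely iff it is
  injective.\<close>

definition code :: "'a set \<Rightarrow> 'a list set \<Rightarrow> bool" where
  "code A X \<longleftrightarrow> X \<noteq> {} \<and> X \<subseteq> lists A - {[]} \<and> inj_on concat (lists X)"

definition bifix_code :: "'a set \<Rightarrow> 'a list set \<Rightarrow> bool" where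
  "bifix_code A X \<longleftrightarrow>
     code A X \<and> (\<forall>x\<in>X. \<forall>y\<in>X. \<not> strict_prefix x y \<and> \<not> strict_suffix x y)"

definition covers :: "'a list set \<Rightarrow> 'a list set \<Rightarrow> bool" where
  "covers X F \<longleftrightarrow>
     (\<forall>u\<in>F. (\<exists>w\<in>generated_submonoid X. prefix u w) \<and> (\<exists>w\<in>generated_submonoid X. suffix u w))"

definition complete_code :: "'a set \<Rightarrow> 'a list set \<Rightarrow> bool" where
  "complete_code A Z \<longleftrightarrow> code A Z \<and> covers Z (lists A)"

definition F_complete_code :: "'a set \<Rightarrow> 'a list set \<Rightarrow> 'a list set \<Rightarrow> bool" where
  "F_complete_code A F X \<longleftrightarrow> code A X \<and> X \<subseteq> F \<and> covers X F"

definition decoding :: "'a list set \<Rightarrow> 'a list set \<Rightarrow> 'a list list set" where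
  "decoding X F = {ws \<in> lists X. concat ws \<in> F}"

section \<open>Green's relations\<close>

definition J_le :: "('m, 'b) monoid_scheme \<Rightarrow> 'm \<Rightarrow> 'm \<Rightarrow> bool" where
  "J_le M x y \<longleftrightarrow> (\<exists>s\<in>carrier M. \<exists>t\<in>carrier M. x = s \<otimes>\<^bsub>M\<^esub> y \<otimes>\<^bsub>M\<^esub> t)"

definition R_le :: "('m, 'b) monoid_scheme \<Rightarrow> 'm \<Rightarrow> 'm \<Rightarrow> bool" where
  "R_le M x y \<longleftrightarrow> (\<exists>t\<in>carrier M. x = y \<otimes>\<^bsub>M\<^esub> t)"

definition L_le :: "('m, 'b) monoid_scheme \<Rightarrow> 'm \<Rightarrow> 'm \<Rightarrow> bool" where
  "L_le M x y \<longleftrightarrow> (\<exists>s\<in>carrier M. x = s \<otimes>\<^bsub>M\<^esub> y)"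

definition R_rel :: "('m, 'b) monoid_scheme \<Rightarrow> 'm rel" where
  "R_rel M = {(x, y) \<in> carrier M \<times> carrier M. R_le M x y \<and> R_le M y x}"

definition L_rel :: "('m, 'b) monoid_scheme \<Rightarrow> 'm rel" where
  "L_rel M = {(x, y) \<in> carrier M \<times> carrier M. L_le M x y \<and> L_le M y x}"

definition H_rel :: "('m, 'b) monoid_scheme \<Rightarrow> 'm rel" where
  "H_rel M = R_rel M \<inter> L_rel M"

definition maximal_subgroup :: "('m, 'b) monoid_scheme \<Rightarrow> 'm set \<Rightarrow> bool" where
  "maximal_subgroup M K \<longleftrightarrow> K \<in> carrier M // H_rel M \<and> (\<exists>e\<in>K. e \<otimes>\<^bsub>M\<^esub> e = e)"

definition monoid_ideal :: "('m, 'b) monoid_scheme \<Rightarrow> 'm set \<Rightarrow> bool" where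
  "monoid_ideal M I \<longleftrightarrow>
     I \<subseteq> carrier M \<and> I \<noteq> {} \<and>
     (\<forall>x\<in>I. \<forall>s\<in>carrier M. s \<otimes>\<^bsub>M\<^esub> x \<in> I \<and> x \<otimes>\<^bsub>M\<^esub> s \<in> I)"

text \<open>Only used for finite monoids, where this intersection is itself a (nonempty) ideal, hence the
  least one.\<close>

definition minimum_ideal :: "('m, 'b) monoid_scheme \<Rightarrow> 'm set" where
  "minimum_ideal M = \<Inter> {I. monoid_ideal M I}"

section \<open>Quotients of the free monoid and the syntactic monoid\<close>

definition word_congruence :: "'a set \<Rightarrow> 'a list rel \<Rightarrow> bool" where
  "word_congruence A \<theta> \<longleftrightarrow>
     equiv (lists A) \<theta> \<and>
     (\<forall>(u, u')\<in>\<theta>. \<forall>(v, v')\<in>\<theta>. (u @ v, u' @ v') \<in> \<theta>)"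

definition quotient_monoid :: "'a set \<Rightarrow> 'a list rel \<Rightarrow> 'a list set monoid" where
  "quotient_monoid A \<theta> =
     \<lparr>carrier = lists A // \<theta>,
      mult = (\<lambda>P Q. \<theta> `` {u @ v | u v. u \<in> P \<and> v \<in> Q}),
      one = \<theta> `` {[]}\<rparr>"

definition syntactic_congruence :: "'a set \<Rightarrow> 'a list set \<Rightarrow> 'a list rel" where
  "syntactic_congruence A L =
     {(u, v) \<in> lists A \<times> lists A.
        \<forall>x\<in>lists A. \<forall>y\<in>lists A. x @ u @ y \<in> L \<longleftrightarrow> x @ v @ y \<in> L}"

definition syntactic_monoid :: "'a set \<Rightarrow> 'a list set \<Rightarrow> 'a list set monoid" where
  "syntactic_monoid A L = quotient_monoid A (syntactic_congruence A L)"

definition syntactic_hom :: "'a set \<Rightarrow> 'a list set \<Rightarrow> 'a list \<Rightarrow> 'a list set" where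
  "syntactic_hom A L u = syntactic_congruence A L `` {u}"

section \<open>The free profinite monoid\<close>

text \<open>The free profinite monoid is constructed as the projective limit of the finite quotients of
  the free monoid on \<open>A\<close>, indexed by the congruences of finite index: its elements are the
  compatible families of congruence classes, and its topology is induced by the product of the
  discrete topologies.\<close>

definition finite_index_congruences :: "'a set \<Rightarrow> 'a list rel set" where
  "finite_index_congruences A = {\<theta>. word_congruence A \<theta> \<and> finite (lists A // \<theta>)}"

type_synonym 'a profinite = "'a list rel \<Rightarrow> 'a list set"

definition free_profinite_monoid :: "'a set \<Rightarrow> 'a profinite monoid" where
  "free_profinite_monoid A =
     \<lparr>carrier = {x \<in> \<Pi>\<^sub>E \<theta>\<in>finite_index_congruences A. carrier (quotient_monoid A \<theta>).
        \<forall>\<theta>\<in>finite_index_congruences A. \<forall>\<rho>\<in>finite_index_congruences A. \<theta> \<subseteq> \<rho> \<longrightarrow> x \<theta> \<subseteq> x \<rho>},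
      mult = (\<lambda>x y. \<lambda>\<theta>\<in>finite_index_congruences A. x \<theta> \<otimes>\<^bsub>quotient_monoid A \<theta>\<^esub> y \<theta>),
      one = (\<lambda>\<theta>\<in>finite_index_congruences A. \<one>\<^bsub>quotient_monoid A \<theta>\<^esub>)\<rparr>"

definition profinite_topology :: "'a set \<Rightarrow> 'a profinite topology" where
  "profinite_topology A =
     subtopology
       (product_topology (\<lambda>\<theta>. discrete_topology (carrier (quotient_monoid A \<theta>)))
          (finite_index_congruences A))
       (carrier (free_profinite_monoid A))"

definition profinite_word :: "'a set \<Rightarrow> 'a list \<Rightarrow> 'a profinite" where
  "profinite_word A u = (\<lambda>\<theta>\<in>finite_index_congruences A. \<theta> `` {u})"

definition profinite_closure :: "'a set \<Rightarrow> 'a list set \<Rightarrow> 'a profinite set" where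
  "profinite_closure A L = (profinite_topology A) closure_of (profinite_word A ` L)"

text \<open>The continuous extension of the syntactic homomorphism. It exists, and is unique, whenever
  the syntactic monoid is finite.\<close>

definition syntactic_ext :: "'a set \<Rightarrow> 'a list set \<Rightarrow> 'a profinite \<Rightarrow> 'a list set" where
  "syntactic_ext A L =
     (THE h. h \<in> extensional (carrier (free_profinite_monoid A)) \<and>
        continuous_map (profinite_topology A)
          (discrete_topology (carrier (syntactic_monoid A L))) h \<and>
        (\<forall>u\<in>lists A. h (profinite_word A u) = syntactic_hom A L u))"

definition J_class_of_language :: "'a set \<Rightarrow> 'a list set \<Rightarrow> 'a profinite set" where
  "J_class_of_language A F =
     {x \<in> profinite_closure A F.
        \<forall>y\<in>profinite_closure A F.
          J_le (free_profinite_monoid A) y x \<longrightarrow> J_le (free_profinite_monoid A) x y}"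

section \<open>Charged codes\<close>

definition charged_code :: "'a set \<Rightarrow> 'a list set \<Rightarrow> 'a list set \<Rightarrow> bool" where
  "charged_code A F Z \<longleftrightarrow>
     recurrent A F \<and> rational A Z \<and> bifix_code A Z \<and> complete_code A Z \<and>
     (\<forall>K. maximal_subgroup (free_profinite_monoid A) K \<and> K \<subseteq> J_class_of_language A F \<longrightarrow>
        maximal_subgroup (syntactic_monoid A (generated_submonoid Z))
          (syntactic_ext A (generated_submonoid Z) ` K) \<and>
        syntactic_ext A (generated_submonoid Z) ` K
          \<subseteq> minimum_ideal (syntactic_monoid A (generated_submonoid Z)))"

definition F_complete_charged_code :: "'a set \<Rightarrow> 'a list set \<Rightarrow> 'a list set \<Rightarrow> bool" where
  "F_complete_charged_code A F X \<longleftrightarrow>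
     rational A X \<and> F_complete_code A F X \<and> (\<exists>Z. charged_code A F Z \<and> X = Z \<inter> F)"

end

theory Submission
  imports Defs "HOL-Library.Ramsey"
begin

text \<open>Let \<open>w \<in> F \<inter> X\<^sup>*\<close>. By compactness and uniform recurrence there is an idempotent \<open>e\<close> in the
  \<open>\<J>\<close>-class of \<open>F\<close> having \<open>w\<close> as a factor, say \<open>e = p w q\<close>. Let \<open>K\<close> be its maximal
  subgroup and \<open>\<eta>\<close> the extended syntactic homomorphism of \<open>Z\<^sup>*\<close>. Every \<open>k \<in> K\<close> gives a
  factorization \<open>e = (k e p) w q'\<close>. As multiplication is open, some \<open>T \<in> F\<close> close to \<open>e\<close> has,
  for all \<open>k\<close> simultaneously, a factorization \<open>T = u w v\<close> with \<open>\<eta>(u) = \<eta>(k e p)\<close>. Since \<open>\<eta>(K)\<close>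
  is a full maximal subgroup in the minimum ideal, for each word \<open>a\<close> some \<open>k\<close> makes
  \<open>\<eta>(a) \<eta>(k e p)\<close> idempotent, and for a complete bifix code this forces \<open>a u \<in> Z\<^sup>*\<close>. So wherever
  \<open>T\<close> occurs in a word of \<open>F \<inter> X\<^sup>*\<close>, it contains an occurrence of \<open>w\<close> respecting the
  factorization over \<open>X\<close>; and \<open>T\<close> occurs in all long words of \<open>F\<close>.\<close>

section \<open>Congruences of finite index\<close>

text \<open>The delicate point is the order of choices: \<open>T\<close> must be fixed before it is
  known what precedes its occurrence. A preceding word matters only through its image in a finite
  monoid, and an element of the group \<eta>(K) corrects each such image. That the group is a full
  H-class in the minimum ideal is what supplies these corrections: by stability of finite monoids,
  any element h with e h = h = h e, for an idempotent e of the minimum ideal, lies in the H-class of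
  e. The factorizations attached to the various \<open>k\<close> all multiply to the same
  \<open>e\<close>, so one congruence, independent of \<open>k\<close>, lets a single
  \<open>T\<close> inherit them all. The idempotent \<open>e\<close> originates in Ramsey's theorem,
  applied in each finite quotient to the factors of an infinite word, the results being glued by
  compactness. Requiring representatives in \<open>F\<close> of unbounded length is what places
  \<open>e\<close> J-below the whole closure of \<open>F\<close>. An idempotent class meets only
  words of the submonoid because completeness supplies a right context and the suffix property
  cancels it again.\<close>

lemma word_congruence_equiv: "word_congruence A \<theta> \<Longrightarrow> equiv (lists A) \<theta>"
  by (simp add: word_congruence_def)

lemma word_congruence_refl: "word_congruence A \<theta> \<Longrightarrow> u \<in> lists A \<Longrightarrow> (u, u) \<in> \<theta>"
  unfolding word_congruence_def equiv_def refl_on_def by auto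

lemma word_congruence_trans:
  "word_congruence A \<theta> \<Longrightarrow> (u, v) \<in> \<theta> \<Longrightarrow> (v, w) \<in> \<theta> \<Longrightarrow> (u, w) \<in> \<theta>"
  unfolding word_congruence_def equiv_def by (meson transD)

lemma word_congruence_append:
  "word_congruence A \<theta> \<Longrightarrow> (u, u') \<in> \<theta> \<Longrightarrow> (v, v') \<in> \<theta> \<Longrightarrow> (u @ v, u' @ v') \<in> \<theta>"
  unfolding word_congruence_def by fast

lemma word_congruence_class_eq:
  "word_congruence A \<theta> \<Longrightarrow> u \<in> lists A \<Longrightarrow> v \<in> lists A \<Longrightarrow>
    \<theta> `` {u} = \<theta> `` {v} \<longleftrightarrow> (u, v) \<in> \<theta>"
  using eq_equiv_class_iff[OF word_congruence_equiv] by blast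

lemma word_congruence_kernel:
  fixes f :: "'a list \<Rightarrow> 'b"
  assumes "\<And>u u' v v'. u \<in> lists A \<Longrightarrow> u' \<in> lists A \<Longrightarrow> v \<in> lists A \<Longrightarrow> v' \<in> lists A \<Longrightarrow>
    f u = f u' \<Longrightarrow> f v = f v' \<Longrightarrow> f (u @ v) = f (u' @ v')"
  shows "word_congruence A {(u, v) \<in> lists A \<times> lists A. f u = f v}"
  unfolding word_congruence_def
proof (intro conjI)
  show "equiv (lists A) {(u, v) \<in> lists A \<times> lists A. f u = f v}"
    by (rule equivI) (auto simp: refl_on_def sym_def trans_def)
qed (use assms in auto)

lemma finite_quotient_kernel:
  assumes "finite (f ` S)"
  shows "finite (S // {(u, v) \<in> S \<times> S. f u = f v})"
proof (rule finite_subset)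
  show "S // {(u, v) \<in> S \<times> S. f u = f v} \<subseteq> (\<lambda>y. {u \<in> S. f u = y}) ` (f ` S)"
  proof
    fix P assume "P \<in> S // {(u, v) \<in> S \<times> S. f u = f v}"
    then obtain u where "u \<in> S" "P = {(u, v) \<in> S \<times> S. f u = f v} `` {u}"
      by (rule quotientE)
    then have "P = {v \<in> S. f v = f u}" by auto
    with \<open>u \<in> S\<close> show "P \<in> (\<lambda>y. {u \<in> S. f u = y}) ` (f ` S)" by blast
  qed
qed (use assms in simp)

text \<open>Congruences of finite index are produced as kernels of invariants with finitely many
  values; all that is left to check is that the invariant of a product depends only on those of its
  factors.\<close>

lemma finite_index_kernel:
  fixes f :: "'a list \<Rightarrow> 'b"
  assumes "\<And>u u' v v'. u \<in> lists A \<Longrightarrow> u' \<in> lists A \<Longrightarrow> v \<in> lists A \<Longrightarrow> v' \<in> lists A \<Longrightarrow>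
    f u = f u' \<Longrightarrow> f v = f v' \<Longrightarrow> f (u @ v) = f (u' @ v')"
    and "finite (f ` lists A)"
  shows "{(u, v) \<in> lists A \<times> lists A. f u = f v} \<in> finite_index_congruences A"
  unfolding finite_index_congruences_def mem_Collect_eq
proof
  show "word_congruence A {(u, v) \<in> lists A \<times> lists A. f u = f v}"
    by (rule word_congruence_kernel) (rule assms(1))
qed (rule finite_quotient_kernel[OF assms(2)])

lemma finite_index_congruencesD:
  assumes "\<theta> \<in> finite_index_congruences A"
  shows "word_congruence A \<theta>" "finite (lists A // \<theta>)"
  using assms by (auto simp: finite_index_congruences_def)

lemma finite_index_congruences_top: "lists A \<times> lists A \<in> finite_index_congruences A"
  using finite_index_kernel[of A "\<lambda>_. ()"] by simp

lemma finite_index_congruences_Int: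
  assumes "\<theta> \<in> finite_index_congruences A" "\<rho> \<in> finite_index_congruences A"
  shows "\<theta> \<inter> \<rho> \<in> finite_index_congruences A"
proof -
  note \<theta> = finite_index_congruencesD[OF assms(1)] and \<rho> = finite_index_congruencesD[OF assms(2)]
  have "word_congruence A (\<theta> \<inter> \<rho>)"
    unfolding word_congruence_def
  proof (intro conjI)
    show "equiv (lists A) (\<theta> \<inter> \<rho>)"
      using word_congruence_equiv[OF \<theta>(1)] word_congruence_equiv[OF \<rho>(1)]
      unfolding equiv_def refl_on_def by (auto intro: sym_Int trans_Int)
  qed (use word_congruence_append[OF \<theta>(1)] word_congruence_append[OF \<rho>(1)] in blast)
  moreover have "lists A // (\<theta> \<inter> \<rho>) \<subseteq> (\<lambda>(P, Q). P \<inter> Q) ` ((lists A // \<theta>) \<times> (lists A // \<rho>))"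
  proof
    fix P assume "P \<in> lists A // (\<theta> \<inter> \<rho>)"
    then obtain u where "u \<in> lists A" "P = \<theta> `` {u} \<inter> \<rho> `` {u}"
      by (auto simp: quotient_def)
    then show "P \<in> (\<lambda>(P, Q). P \<inter> Q) ` ((lists A // \<theta>) \<times> (lists A // \<rho>))"
      by (force intro: quotientI)
  qed
  then have "finite (lists A // (\<theta> \<inter> \<rho>))"
    using \<theta>(2) \<rho>(2) by (auto intro: finite_subset)
  ultimately show ?thesis
    by (simp add: finite_index_congruences_def)
qed

text \<open>Intersections keep the index finite. Hence finitely many coordinates of a profinite
  element are controlled by a single one, which is how product neighbourhoods are reduced to one
  congruence.\<close>

lemma finite_index_congruences_directed:
  assumes "finite T" "T \<subseteq> finite_index_congruences A"
  shows "\<exists>\<theta>\<in>finite_index_congruences A. \<forall>\<rho>\<in>T. \<theta> \<subseteq> \<rho>"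
  using assms
proof (induction T rule: finite_induct)
  case empty
  then show ?case using finite_index_congruences_top by blast
next
  case (insert \<rho> T)
  then obtain \<theta> where "\<theta> \<in> finite_index_congruences A" "\<forall>\<sigma>\<in>T. \<theta> \<subseteq> \<sigma>"
    by auto
  with insert.prems show ?case
    by (intro bexI[of _ "\<theta> \<inter> \<rho>"]) (auto intro: finite_index_congruences_Int)
qed

section \<open>Congruences that lift factorizations\<close>

lemma append_eq_appendE:
  assumes "u @ v = s @ t"
  obtains m where "u = s @ m \<and> m @ v = t \<or> u @ m = s \<and> v = m @ t"
  using iffD1[OF append_eq_append_conv2 assms] by (elim exE) (rule that)

text \<open>All cuts are recorded at once, those with an empty half included. There are finitely
  many pairs of classes, so this set is a finite-valued invariant of the word.\<close>

definition splits :: "'a list rel \<Rightarrow> 'a list \<Rightarrow> ('a list set \<times> 'a list set) set" where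
  "splits \<theta> u = {(\<theta> `` {u1}, \<theta> `` {u2}) | u1 u2. u = u1 @ u2}"

lemma splitsI: "u = u1 @ u2 \<Longrightarrow> (\<theta> `` {u1}, \<theta> `` {u2}) \<in> splits \<theta> u"
  unfolding splits_def by blast

lemma splitsE:
  assumes "c \<in> splits \<theta> u"
  obtains u1 u2 where "u = u1 @ u2" "c = (\<theta> `` {u1}, \<theta> `` {u2})"
  using assms unfolding splits_def by blast

text \<open>A cut of a product falls inside one of the two factors; the other factor then enters
  only through its class, which its own set of cuts determines. Exchanging the primed and unprimed
  words gives equality.\<close>

lemma splits_append:
  assumes "word_congruence A \<theta>" "u \<in> lists A" "v \<in> lists A" "u' \<in> lists A" "v' \<in> lists A"
    and eq: "splits \<theta> u = splits \<theta> u'" "splits \<theta> v = splits \<theta> v'"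
  shows "splits \<theta> (u @ v) \<subseteq> splits \<theta> (u' @ v')"
proof -
  \<comment> \<open>The cut of \<open>x\<close> with empty left half is matched by a cut of
    \<open>x'\<close> whose left half is congruent to the empty word, so the class of the whole word
    is recovered.\<close>
  have class_eq: "(x, x') \<in> \<theta>" if "splits \<theta> x = splits \<theta> x'" "x \<in> lists A" "x' \<in> lists A" for x x'
  proof -
    have "(\<theta> `` {[]}, \<theta> `` {x}) \<in> splits \<theta> x'"
      unfolding that(1)[symmetric] by (rule splitsI) simp
    then obtain x1 x2 where *: "x' = x1 @ x2" "\<theta> `` {[]} = \<theta> `` {x1}" "\<theta> `` {x} = \<theta> `` {x2}"
      by (auto elim: splitsE)
    then have "([], x1) \<in> \<theta>" "(x, x2) \<in> \<theta>"
      using that word_congruence_class_eq[OF assms(1)] by auto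
    from word_congruence_append[OF assms(1) this] show ?thesis
      using * by simp
  qed
  show ?thesis
  proof
    fix c assume "c \<in> splits \<theta> (u @ v)"
    then obtain s t where c: "c = (\<theta> `` {s}, \<theta> `` {t})" and st: "u @ v = s @ t"
      by (auto elim: splitsE)
    obtain m where "u = s @ m \<and> m @ v = t \<or> u @ m = s \<and> v = m @ t"
      by (rule append_eq_appendE[OF st])
    then show "c \<in> splits \<theta> (u' @ v')"
    proof
      assume m: "u = s @ m \<and> m @ v = t"
      then have "(\<theta> `` {s}, \<theta> `` {m}) \<in> splits \<theta> u'"
        unfolding eq(1)[symmetric] by (intro splitsI) simp
      then obtain s' m' where u': "u' = s' @ m'" "\<theta> `` {s} = \<theta> `` {s'}" "\<theta> `` {m} = \<theta> `` {m'}"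
        by (auto elim: splitsE)
      then have "(m @ v, m' @ v') \<in> \<theta>"
        using m assms class_eq[OF eq(2)] word_congruence_class_eq[OF assms(1)]
        by (intro word_congruence_append[OF assms(1)]) auto
      then have "\<theta> `` {t} = \<theta> `` {m' @ v'}"
        using m equiv_class_eq[OF word_congruence_equiv[OF assms(1)]] by metis
      with u' have "c = (\<theta> `` {s'}, \<theta> `` {m' @ v'})" using c by simp
      with u' show ?thesis by (simp add: splitsI)
    next
      assume m: "u @ m = s \<and> v = m @ t"
      then have "(\<theta> `` {m}, \<theta> `` {t}) \<in> splits \<theta> v'"
        unfolding eq(2)[symmetric] by (intro splitsI) simp
      then obtain m' t' where v': "v' = m' @ t'" "\<theta> `` {m} = \<theta> `` {m'}" "\<theta> `` {t} = \<theta> `` {t'}"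
        by (auto elim: splitsE)
      then have "(u @ m, u' @ m') \<in> \<theta>"
        using m assms class_eq[OF eq(1)] word_congruence_class_eq[OF assms(1)]
        by (intro word_congruence_append[OF assms(1)]) auto
      then have "\<theta> `` {s} = \<theta> `` {u' @ m'}"
        using m equiv_class_eq[OF word_congruence_equiv[OF assms(1)]] by metis
      with v' have "c = (\<theta> `` {u' @ m'}, \<theta> `` {t'})" using c by simp
      with v' show ?thesis by (simp add: splitsI)
    qed
  qed
qed

text \<open>This is what makes the multiplication of the free profinite monoid an open map.\<close>

lemma split_congruence:
  assumes "\<theta> \<in> finite_index_congruences A"
  obtains \<rho> where "\<rho> \<in> finite_index_congruences A" "\<rho> \<subseteq> \<theta>"
    "\<forall>t u v. (t, u @ v) \<in> \<rho> \<longrightarrow> (\<exists>u' v'. t = u' @ v' \<and> (u', u) \<in> \<theta> \<and> (v', v) \<in> \<theta>)"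
proof
  note \<theta> = finite_index_congruencesD[OF assms]
  let ?\<rho> = "{(u, v) \<in> lists A \<times> lists A. splits \<theta> u = splits \<theta> v}"
  show "?\<rho> \<in> finite_index_congruences A"
  proof (rule finite_index_kernel)
    show "splits \<theta> (u @ v) = splits \<theta> (u' @ v')"
      if "u \<in> lists A" "u' \<in> lists A" "v \<in> lists A" "v' \<in> lists A"
        "splits \<theta> u = splits \<theta> u'" "splits \<theta> v = splits \<theta> v'" for u u' v v'
      using splits_append[OF \<theta>(1) that(1,3,2,4)] splits_append[OF \<theta>(1) that(2,4,1,3)] that by auto
    have "splits \<theta> ` lists A \<subseteq> Pow ((lists A // \<theta>) \<times> (lists A // \<theta>))"
      by (auto simp: splits_def intro!: quotientI)
    then show "finite (splits \<theta> ` lists A)"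
      by (rule finite_subset) (use \<theta>(2) in auto)
  qed
  have split: "\<exists>u' v'. t = u' @ v' \<and> (u', u) \<in> \<theta> \<and> (v', v) \<in> \<theta>" if "(t, u @ v) \<in> ?\<rho>" for t u v
  proof -
    have "splits \<theta> t = splits \<theta> (u @ v)" using that by simp
    then have "(\<theta> `` {u}, \<theta> `` {v}) \<in> splits \<theta> t"
      by (simp add: splitsI)
    then obtain u' v' where "t = u' @ v'" "\<theta> `` {u} = \<theta> `` {u'}" "\<theta> `` {v} = \<theta> `` {v'}"
      by (auto elim: splitsE)
    with that show ?thesis
      using word_congruence_class_eq[OF \<theta>(1)] by (metis (no_types, lifting) SigmaD1 SigmaD2
          append_in_lists_conv case_prodD mem_Collect_eq)
  qed
  then show "\<forall>t u v. (t, u @ v) \<in> ?\<rho> \<longrightarrow> (\<exists>u' v'. t = u' @ v' \<and> (u', u) \<in> \<theta> \<and> (v', v) \<in> \<theta>)"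
    by simp
  show "?\<rho> \<subseteq> \<theta>"
  proof (rule subrelI)
    fix t u assume tu: "(t, u) \<in> ?\<rho>"
    \<comment> \<open>Lifting the cut with empty left half shows that the new congruence refines
      \<open>\<theta>\<close>.\<close>
    then obtain u' v' where "t = u' @ v'" "(u', []) \<in> \<theta>" "(v', u) \<in> \<theta>"
      using split[of t "[]" u] by auto
    with word_congruence_append[OF \<theta>(1)] show "(t, u) \<in> \<theta>"
      by fastforce
  qed
qed

section \<open>Rational languages have finite syntactic monoids\<close>

text \<open>These sets are the states of the minimal automaton of \<open>L\<close> (its Brzozowski
  derivatives).\<close>

definition left_quotient :: "'a set \<Rightarrow> 'a list set \<Rightarrow> 'a list \<Rightarrow> 'a list set" where
  "left_quotient A L u = {y \<in> lists A. u @ y \<in> L}"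

lemma left_quotientI: "y \<in> lists A \<Longrightarrow> u @ y \<in> L \<Longrightarrow> y \<in> left_quotient A L u"
  by (simp add: left_quotient_def)

lemma left_quotient_append:
  "v \<in> lists A \<Longrightarrow> left_quotient A L (u @ v) = left_quotient A (left_quotient A L u) v"
  by (auto simp: left_quotient_def)

lemma rational_subset: "rational A L \<Longrightarrow> L \<subseteq> lists A"
proof (induction rule: rational.induct)
  case (star L)
  have "concat ws \<in> lists A" if "ws \<in> lists L" for ws
    using that star.IH by (induction ws) auto
  then show ?case by (auto simp: generated_submonoid_def)
qed (auto dest!: subsetD)

lemma generated_submonoid_Nil: "[] \<in> generated_submonoid X"
  unfolding generated_submonoid_def by (rule image_eqI[of _ _ "[]"]) auto

lemma generated_submonoid_append:
  "u \<in> generated_submonoid X \<Longrightarrow> v \<in> generated_submonoid X \<Longrightarrow> u @ v \<in> generated_submonoid X"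
  unfolding generated_submonoid_def image_iff
proof (elim bexE)
  fix us vs assume "us \<in> lists X" "vs \<in> lists X" "u = concat us" "v = concat vs"
  then show "\<exists>ws\<in>lists X. u @ v = concat ws"
    by (intro bexI[of _ "us @ vs"]) auto
qed

lemma generated_submonoid_base: "u \<in> X \<Longrightarrow> u \<in> generated_submonoid X"
  unfolding generated_submonoid_def by (rule image_eqI[of _ _ "[u]"]) auto

text \<open>The generator \<open>v @ y\<close> is the one containing the last letter of
  \<open>u\<close>; this is why \<open>u\<close> must be nonempty. It describes the left quotients
  of a star.\<close>

lemma generated_submonoid_cut:
  assumes "u @ x \<in> generated_submonoid L" "u \<noteq> []"
  shows "\<exists>u' v y z. u = u' @ v \<and> x = y @ z \<and> u' \<in> generated_submonoid L \<and> v @ y \<in> L \<and>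
    z \<in> generated_submonoid L"
proof -
  have *: "\<exists>u' v y z. u = u' @ v \<and> x = y @ z \<and> u' \<in> generated_submonoid L \<and> v @ y \<in> L \<and>
    z \<in> generated_submonoid L" if "ws \<in> lists L" "u @ x = concat ws" "u \<noteq> []" for ws
    using that
  proof (induction ws arbitrary: u rule: list.induct)
    case (Cons w ws)
    then have "u @ x = w @ concat ws" by simp
    then obtain m where "u = w @ m \<and> m @ x = concat ws \<or> u @ m = w \<and> x = m @ concat ws"
      by (rule append_eq_appendE)
    then show ?case
    proof
      assume m: "u = w @ m \<and> m @ x = concat ws"
      have w: "w \<in> L" "ws \<in> lists L" using Cons.prems by auto
      show ?thesis
      proof (cases "m = []")
        \<comment> \<open>The cut falls on a boundary between generators: \<open>u'\<close> and
          \<open>y\<close> are both empty, \<open>v\<close> is \<open>w\<close> and \<open>z\<close>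
          is \<open>x\<close>.\<close>
        case True
        then show ?thesis
          using m w generated_submonoid_Nil
          by (intro exI[of _ "[]"] exI[of _ w] exI[of _ x]) (auto simp: generated_submonoid_def)
      next
        case False
        with Cons.IH[of m] m w obtain u' v y z where "m = u' @ v" "x = y @ z"
          "u' \<in> generated_submonoid L" "v @ y \<in> L" "z \<in> generated_submonoid L" by auto
        with m w show ?thesis
          by (intro exI[of _ "w @ u'"] exI[of _ v] exI[of _ y] exI[of _ z])
            (auto intro: generated_submonoid_append generated_submonoid_base)
      qed
    next
      assume m: "u @ m = w \<and> x = m @ concat ws"
      with Cons.prems show ?thesis
        by (intro exI[of _ "[]"] exI[of _ u] exI[of _ m] exI[of _ "concat ws"])
          (auto simp: generated_submonoid_Nil, auto simp: generated_submonoid_def)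
    qed
  qed auto
  from assms(1) obtain ws where "ws \<in> lists L" "u @ x = concat ws"
    unfolding generated_submonoid_def by (elim imageE)
  from *[OF this assms(2)] show ?thesis .
qed

lemma productI: "u \<in> K \<Longrightarrow> v \<in> L \<Longrightarrow> u @ v \<in> {u @ v | u v. u \<in> K \<and> v \<in> L}"
  by blast

text \<open>One half of Kleene's theorem. A left quotient of a compound language is determined by
  quotients, or sets of quotients, of its parts, so it takes finitely many values if theirs
  do.\<close>

lemma finite_left_quotients:
  assumes "rational A L"
  shows "finite (left_quotient A L ` lists A)"
  using assms
proof (induction rule: rational.induct)
  case (finite L)
  have "left_quotient A L ` lists A \<subseteq> Pow (\<Union>w\<in>L. set (suffixes w))"
    by (auto simp: left_quotient_def suffix_def)
  then show ?case
    by (rule finite_subset) (use finite in auto)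
next
  case (union K L)
  have "left_quotient A (K \<union> L) ` lists A
      \<subseteq> (\<lambda>(P, Q). P \<union> Q) ` ((left_quotient A K ` lists A) \<times> (left_quotient A L ` lists A))"
  proof (rule image_subsetI)
    fix x assume "x \<in> lists A"
    moreover have "left_quotient A (K \<union> L) x = left_quotient A K x \<union> left_quotient A L x"
      by (auto simp: left_quotient_def)
    ultimately show "left_quotient A (K \<union> L) x \<in> (\<lambda>(P, Q). P \<union> Q) `
        ((left_quotient A K ` lists A) \<times> (left_quotient A L ` lists A))"
      by (intro image_eqI[of _ _ "(left_quotient A K x, left_quotient A L x)"]) auto
  qed
  then show ?case
    by (rule finite_subset) (use union in auto)
next
  case (product K L)
  let ?KL = "{u @ v | u v. u \<in> K \<and> v \<in> L}"
  have KL: "K \<subseteq> lists A" "L \<subseteq> lists A" using product rational_subset by auto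
  have "left_quotient A ?KL ` lists A \<subseteq> (\<lambda>(P, S). {u @ v | u v. u \<in> P \<and> v \<in> L} \<union> \<Union> S) `
      ((left_quotient A K ` lists A) \<times> Pow (left_quotient A L ` lists A))"
  proof (rule image_subsetI)
    fix x assume x: "x \<in> lists A"
    \<comment> \<open>What remains to be read in \<open>L\<close> once a prefix of \<open>x\<close>
      has been accepted by \<open>K\<close>. The number of such prefixes is unbounded in
      \<open>x\<close>, but only the set of resulting quotients matters.\<close>
    let ?S = "{left_quotient A L v | u v. x = u @ v \<and> u \<in> K}"
    have "left_quotient A ?KL x = {u @ v | u v. u \<in> left_quotient A K x \<and> v \<in> L} \<union> \<Union> ?S"
    proof (rule equalityI; rule subsetI)
      fix y assume y: "y \<in> left_quotient A ?KL x"
      then obtain u v where uv: "x @ y = u @ v" "u \<in> K" "v \<in> L" "y \<in> lists A"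
        by (auto simp: left_quotient_def)
      obtain m where "x = u @ m \<and> m @ y = v \<or> x @ m = u \<and> y = m @ v"
        by (rule append_eq_appendE[OF uv(1)])
      then show "y \<in> {u @ v | u v. u \<in> left_quotient A K x \<and> v \<in> L} \<union> \<Union> ?S"
      proof
        assume "x = u @ m \<and> m @ y = v"
        with uv have "y \<in> left_quotient A L m" "left_quotient A L m \<in> ?S"
          by (auto simp: left_quotient_def)
        then show ?thesis by blast
      next
        assume "x @ m = u \<and> y = m @ v"
        with uv show ?thesis by (auto simp: left_quotient_def)
      qed
    next
      fix y assume "y \<in> {u @ v | u v. u \<in> left_quotient A K x \<and> v \<in> L} \<union> \<Union> ?S"
      then show "y \<in> left_quotient A ?KL x"
      proof
        assume "y \<in> {u @ v | u v. u \<in> left_quotient A K x \<and> v \<in> L}"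
        then obtain u v where uv: "y = u @ v" "x @ u \<in> K" "u \<in> lists A" "v \<in> L"
          by (auto simp: left_quotient_def)
        from uv have y: "y \<in> lists A" using KL(2) by auto
        have "(x @ u) @ v \<in> ?KL" by (rule productI[OF uv(2,4)])
        with y show ?thesis
          unfolding uv(1) append_assoc by (intro left_quotientI)
      next
        assume "y \<in> \<Union> ?S"
        then obtain u v where "x = u @ v" "u \<in> K" "y \<in> lists A" "v @ y \<in> L"
          by (auto simp: left_quotient_def)
        then have "x @ y \<in> ?KL" using productI[of u K "v @ y" L] by simp
        with \<open>y \<in> lists A\<close> show ?thesis
          by (rule left_quotientI)
      qed
    qed
    moreover have "?S \<subseteq> left_quotient A L ` lists A" using x by auto
    ultimately show "left_quotient A ?KL x \<in> (\<lambda>(P, S). {u @ v | u v. u \<in> P \<and> v \<in> L} \<union> \<Union> S) `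
      ((left_quotient A K ` lists A) \<times> Pow (left_quotient A L ` lists A))"
      using x by (intro image_eqI[of _ _ "(left_quotient A K x, ?S)"]) auto
  qed
  then show ?case
    by (rule finite_subset) (use product in auto)
next
  case (star L)
  let ?M = "generated_submonoid L"
  have M: "?M \<subseteq> lists A" "L \<subseteq> lists A"
    using star rational_subset rational.star by blast+
  have "left_quotient A ?M ` lists A \<subseteq> insert ?M ((\<lambda>S. {u @ v | u v. u \<in> \<Union> S \<and> v \<in> ?M}) `
      Pow (left_quotient A L ` lists A))"
  proof (rule image_subsetI)
    fix x assume x: "x \<in> lists A"
    show "left_quotient A ?M x \<in> insert ?M ((\<lambda>S. {u @ v | u v. u \<in> \<Union> S \<and> v \<in> ?M}) `
      Pow (left_quotient A L ` lists A))"
    proof (cases "x = []")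
      \<comment> \<open>The quotient by the empty word is the submonoid itself; it is the extra
        value inserted above.\<close>
      case True
      then show ?thesis using M by (auto simp: left_quotient_def)
    next
      case False
      let ?S = "{left_quotient A L v | u v. x = u @ v \<and> u \<in> ?M}"
      have "left_quotient A ?M x = {u @ v | u v. u \<in> \<Union> ?S \<and> v \<in> ?M}"
      proof (rule equalityI; rule subsetI)
        fix y assume "y \<in> left_quotient A ?M x"
        then have "x @ y \<in> ?M" "y \<in> lists A" by (auto simp: left_quotient_def)
        with generated_submonoid_cut[OF this(1) False] obtain u' v a b where
          "x = u' @ v" "y = a @ b" "u' \<in> ?M" "v @ a \<in> L" "b \<in> ?M" by blast
        then have "left_quotient A L v \<in> ?S" "a \<in> left_quotient A L v" "y = a @ b" "b \<in> ?M"
          using \<open>y \<in> lists A\<close> by (blast, auto simp: left_quotient_def)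
        then show "y \<in> {u @ v | u v. u \<in> \<Union> ?S \<and> v \<in> ?M}" by blast
      next
        fix y assume "y \<in> {u @ v | u v. u \<in> \<Union> ?S \<and> v \<in> ?M}"
        then obtain u v a b where "y = a @ b" "b \<in> ?M" "x = u @ v"
          "u \<in> ?M" "a \<in> lists A" "v @ a \<in> L"
          by (auto simp: left_quotient_def)
        then have "u @ (v @ a) @ b \<in> ?M"
          using generated_submonoid_append generated_submonoid_base by metis
        then have "x @ y \<in> ?M" "y \<in> lists A"
          using M \<open>y = a @ b\<close> \<open>x = u @ v\<close> \<open>a \<in> lists A\<close> \<open>b \<in> ?M\<close> by auto
        then show "y \<in> left_quotient A ?M x"
          by (intro left_quotientI)
      qed
      moreover have "?S \<subseteq> left_quotient A L ` lists A" using x by auto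
      ultimately show ?thesis by blast
    qed
  qed
  then show ?case
    by (rule finite_subset) (use star in auto)
qed

text \<open>The congruence is the kernel of the action of words on the states of the minimal
  automaton, and a finite set has finitely many self-maps.\<close>

lemma syntactic_congruence_finite_index:
  assumes "rational A L"
  shows "syntactic_congruence A L \<in> finite_index_congruences A"
proof -
  \<comment> \<open>The transition induced by \<open>v\<close> on the states, written as its
    graph.\<close>
  define f where "f v = (\<lambda>x. (left_quotient A L x, left_quotient A L (x @ v))) ` lists A" for v
  have eq: "left_quotient A L (x @ u) = left_quotient A L (x @ v)"
    if "f u = f v" "x \<in> lists A" for u v x
  proof -
    have "(left_quotient A L x, left_quotient A L (x @ u)) \<in> f v"
      unfolding that(1)[symmetric] unfolding f_def using that(2) by (rule imageI)
    then obtain x' where x': "left_quotient A L x = left_quotient A L x'"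
      "left_quotient A L (x @ u) = left_quotient A L (x' @ v)" "x' \<in> lists A"
      unfolding f_def by (elim imageE) simp
    have "left_quotient A L (x @ v) = left_quotient A L (x' @ v)" if "v \<in> lists A"
      using x'(1) that by (simp add: left_quotient_append)
    \<comment> \<open>Outside \<open>lists A\<close> both quotients are empty, since
      \<open>L\<close> is a language over \<open>A\<close>.\<close>
    moreover have "left_quotient A L (x @ v) = left_quotient A L (x' @ v)" if "v \<notin> lists A"
      using rational_subset[OF assms] that unfolding left_quotient_def by auto
    ultimately show ?thesis using x' by auto
  qed
  have "{(u, v) \<in> lists A \<times> lists A. f u = f v} \<in> finite_index_congruences A"
  proof (rule finite_index_kernel)
    show "f (u @ v) = f (u' @ v')" if uv: "u \<in> lists A" "u' \<in> lists A" "v \<in> lists A" "v' \<in> lists A"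
      "f u = f u'" "f v = f v'" for u u' v v'
    proof -
      have "left_quotient A L (x @ u @ v) = left_quotient A L (x @ u' @ v')" if "x \<in> lists A" for x
      proof -
        have "left_quotient A L (x @ u @ v) = left_quotient A L (x @ u' @ v)"
          using eq[OF uv(5) that] left_quotient_append[OF uv(3), of L "x @ u"]
            left_quotient_append[OF uv(3), of L "x @ u'"] by simp
        also have "\<dots> = left_quotient A L (x @ u' @ v')"
          using eq[OF uv(6), of "x @ u'"] that uv by simp
        finally show ?thesis .
      qed
      then show ?thesis unfolding f_def by (intro image_cong) auto
    qed
    have "f ` lists A \<subseteq> Pow ((left_quotient A L ` lists A) \<times> (left_quotient A L ` lists A))"
      unfolding f_def by (intro image_subsetI PowI SigmaI imageI) auto
    then show "finite (f ` lists A)"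
      by (rule finite_subset) (use finite_left_quotients[OF assms] in auto)
  qed
  moreover have "syntactic_congruence A L = {(u, v) \<in> lists A \<times> lists A. f u = f v}"
  proof (intro equalityI subrelI)
    fix u v assume "(u, v) \<in> syntactic_congruence A L"
    then have uv: "u \<in> lists A" "v \<in> lists A"
      and "\<forall>x\<in>lists A. left_quotient A L (x @ u) = left_quotient A L (x @ v)"
      by (auto simp: syntactic_congruence_def left_quotient_def)
    then have "f u = f v" unfolding f_def by (intro image_cong) auto
    with uv show "(u, v) \<in> {(u, v) \<in> lists A \<times> lists A. f u = f v}" by simp
  next
    fix u v assume "(u, v) \<in> {(u, v) \<in> lists A \<times> lists A. f u = f v}"
    then have uv: "u \<in> lists A" "v \<in> lists A" and "f u = f v" by auto
    then have *: "left_quotient A L (x @ u) = left_quotient A L (x @ v)" if "x \<in> lists A" for x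
      using eq that by blast
    have "x @ u @ y \<in> L \<longleftrightarrow> x @ v @ y \<in> L" if "x \<in> lists A" "y \<in> lists A" for x y
      using *[OF that(1)] that(2) unfolding left_quotient_def set_eq_iff by auto
    with uv show "(u, v) \<in> syntactic_congruence A L"
      by (simp add: syntactic_congruence_def)
  qed
  ultimately show ?thesis by simp
qed

section \<open>The free profinite monoid\<close>

lemma quotient_monoid_simps [simp]:
  "carrier (quotient_monoid A \<theta>) = lists A // \<theta>"
  "\<one>\<^bsub>quotient_monoid A \<theta>\<^esub> = \<theta> `` {[]}"
  by (simp_all add: quotient_monoid_def)

lemma quotient_monoidE:
  assumes "x \<in> carrier (quotient_monoid A \<theta>)"
  obtains u where "u \<in> lists A" "x = \<theta> `` {u}"
  using assms unfolding quotient_monoid_simps by (rule quotientE)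

lemma quotient_monoid_mult:
  assumes "word_congruence A \<theta>" "u \<in> lists A" "v \<in> lists A"
  shows "\<theta> `` {u} \<otimes>\<^bsub>quotient_monoid A \<theta>\<^esub> \<theta> `` {v} = \<theta> `` {u @ v}"
proof -
  have "\<theta> `` {s @ t | s t. s \<in> \<theta> `` {u} \<and> t \<in> \<theta> `` {v}} = \<theta> `` {u @ v}"
  proof (rule equalityI; rule subsetI)
    fix x assume "x \<in> \<theta> `` {s @ t | s t. s \<in> \<theta> `` {u} \<and> t \<in> \<theta> `` {v}}"
    then obtain s t where "(u, s) \<in> \<theta>" "(v, t) \<in> \<theta>" "(s @ t, x) \<in> \<theta>"
      by blast
    then show "x \<in> \<theta> `` {u @ v}"
      using word_congruence_append[OF assms(1)] word_congruence_trans[OF assms(1)] by blast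
  next
    fix x assume "x \<in> \<theta> `` {u @ v}"
    moreover have "u \<in> \<theta> `` {u}" "v \<in> \<theta> `` {v}"
      using assms word_congruence_refl by auto
    ultimately show "x \<in> \<theta> `` {s @ t | s t. s \<in> \<theta> `` {u} \<and> t \<in> \<theta> `` {v}}"
      by blast
  qed
  then show ?thesis by (simp add: quotient_monoid_def)
qed

lemma quotient_monoid_monoid:
  assumes "word_congruence A \<theta>"
  shows "monoid (quotient_monoid A \<theta>)"
proof (rule monoidI)
  fix x y z
  assume x: "x \<in> carrier (quotient_monoid A \<theta>)"
  then obtain u where u: "u \<in> lists A" "x = \<theta> `` {u}" by (rule quotient_monoidE)
  with assms show "\<one>\<^bsub>quotient_monoid A \<theta>\<^esub> \<otimes>\<^bsub>quotient_monoid A \<theta>\<^esub> x = x"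
    "x \<otimes>\<^bsub>quotient_monoid A \<theta>\<^esub> \<one>\<^bsub>quotient_monoid A \<theta>\<^esub> = x"
    using quotient_monoid_mult[OF assms, of "[]" u] quotient_monoid_mult[OF assms, of u "[]"] by simp_all
  assume y: "y \<in> carrier (quotient_monoid A \<theta>)"
  then obtain v where v: "v \<in> lists A" "y = \<theta> `` {v}" by (rule quotient_monoidE)
  with u show "x \<otimes>\<^bsub>quotient_monoid A \<theta>\<^esub> y \<in> carrier (quotient_monoid A \<theta>)"
    using quotient_monoid_mult[OF assms] by (auto intro!: quotientI)
  assume z: "z \<in> carrier (quotient_monoid A \<theta>)"
  then obtain w where "w \<in> lists A" "z = \<theta> `` {w}" by (rule quotient_monoidE)
  with u v show "x \<otimes>\<^bsub>quotient_monoid A \<theta>\<^esub> y \<otimes>\<^bsub>quotient_monoid A \<theta>\<^esub> z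
      = x \<otimes>\<^bsub>quotient_monoid A \<theta>\<^esub> (y \<otimes>\<^bsub>quotient_monoid A \<theta>\<^esub> z)"
    by (simp add: quotient_monoid_mult[OF assms])
qed (auto intro: quotientI)

lemma profinite_component:
  assumes "x \<in> carrier (free_profinite_monoid A)" "\<theta> \<in> finite_index_congruences A"
  shows "x \<theta> \<in> lists A // \<theta>"
  using assms by (auto simp: free_profinite_monoid_def)

lemma profinite_componentE:
  assumes "x \<in> carrier (free_profinite_monoid A)" "\<theta> \<in> finite_index_congruences A"
  obtains u where "u \<in> lists A" "x \<theta> = \<theta> `` {u}"
  using profinite_component[OF assms] by (rule quotientE)

text \<open>Compatibility of a family is an inclusion of classes, and a class containing
  \<open>u\<close> is the class of \<open>u\<close>. So one representative word serves at every
  coarser index.\<close>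

lemma profinite_component_mono:
  assumes "x \<in> carrier (free_profinite_monoid A)"
    and "\<theta> \<in> finite_index_congruences A" "\<rho> \<in> finite_index_congruences A" "\<theta> \<subseteq> \<rho>"
    and "u \<in> lists A" "x \<theta> = \<theta> `` {u}"
  shows "x \<rho> = \<rho> `` {u}"
proof -
  note \<theta> = finite_index_congruencesD[OF assms(2)] and \<rho> = finite_index_congruencesD[OF assms(3)]
  obtain v where v: "v \<in> lists A" "x \<rho> = \<rho> `` {v}"
    using profinite_componentE[OF assms(1,3)] .
  have "x \<theta> \<subseteq> x \<rho>"
    using assms(1-4) by (simp add: free_profinite_monoid_def)
  moreover have "u \<in> x \<theta>"
    using assms word_congruence_refl[OF \<theta>(1)] by simp
  ultimately have "(v, u) \<in> \<rho>" using v by auto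
  with v show ?thesis using word_congruence_class_eq[OF \<rho>(1)] assms(5) by simp
qed

lemma profinite_eqI:
  assumes "x \<in> carrier (free_profinite_monoid A)" "y \<in> carrier (free_profinite_monoid A)"
    and "\<And>\<theta>. \<theta> \<in> finite_index_congruences A \<Longrightarrow> x \<theta> = y \<theta>"
  shows "x = y"
  using assms by (auto simp: free_profinite_monoid_def intro: PiE_ext)

lemma profinite_mult_component:
  "\<theta> \<in> finite_index_congruences A \<Longrightarrow>
    (x \<otimes>\<^bsub>free_profinite_monoid A\<^esub> y) \<theta> = x \<theta> \<otimes>\<^bsub>quotient_monoid A \<theta>\<^esub> y \<theta>"
  by (simp add: free_profinite_monoid_def)

lemma profinite_one_component:
  "\<theta> \<in> finite_index_congruences A \<Longrightarrow> \<one>\<^bsub>free_profinite_monoid A\<^esub> \<theta> = \<theta> `` {[]}"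
  by (simp add: free_profinite_monoid_def)

lemma profinite_word_component:
  "\<theta> \<in> finite_index_congruences A \<Longrightarrow> profinite_word A u \<theta> = \<theta> `` {u}"
  by (simp add: profinite_word_def)

lemma profinite_memI:
  assumes "x \<in> extensional (finite_index_congruences A)"
    and "\<And>\<theta> \<rho>. \<theta> \<in> finite_index_congruences A \<Longrightarrow> \<rho> \<in> finite_index_congruences A \<Longrightarrow> \<theta> \<subseteq> \<rho> \<Longrightarrow>
      \<exists>u\<in>lists A. x \<theta> = \<theta> `` {u} \<and> x \<rho> = \<rho> `` {u}"
  shows "x \<in> carrier (free_profinite_monoid A)"
proof -
  have "x \<in> (\<Pi>\<^sub>E \<theta>\<in>finite_index_congruences A. lists A // \<theta>)"
  proof (rule PiE_I)
    fix \<theta> assume "\<theta> \<in> finite_index_congruences A"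
    from assms(2)[OF this this subset_refl] show "x \<theta> \<in> lists A // \<theta>"
      by (auto intro: quotientI)
  qed (use assms(1) in \<open>auto simp: extensional_def\<close>)
  moreover have "x \<theta> \<subseteq> x \<rho>"
    if "\<theta> \<in> finite_index_congruences A" "\<rho> \<in> finite_index_congruences A" "\<theta> \<subseteq> \<rho>" for \<theta> \<rho>
    using assms(2)[OF that] that(3) by auto
  ultimately show ?thesis
    by (auto simp: free_profinite_monoid_def)
qed

lemma profinite_word_mem:
  assumes "u \<in> lists A"
  shows "profinite_word A u \<in> carrier (free_profinite_monoid A)"
proof (rule profinite_memI)
  show "profinite_word A u \<in> extensional (finite_index_congruences A)"
    by (simp add: profinite_word_def)
qed (use assms profinite_word_component in blast)

lemma profinite_mult_mem:
  assumes "x \<in> carrier (free_profinite_monoid A)" "y \<in> carrier (free_profinite_monoid A)"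
  shows "x \<otimes>\<^bsub>free_profinite_monoid A\<^esub> y \<in> carrier (free_profinite_monoid A)"
proof (rule profinite_memI)
  show "x \<otimes>\<^bsub>free_profinite_monoid A\<^esub> y \<in> extensional (finite_index_congruences A)"
    by (simp add: free_profinite_monoid_def)
  fix \<theta> \<rho>
  assume *: "\<theta> \<in> finite_index_congruences A" "\<rho> \<in> finite_index_congruences A" "\<theta> \<subseteq> \<rho>"
  obtain u where u: "u \<in> lists A" "x \<theta> = \<theta> `` {u}" using profinite_componentE[OF assms(1) *(1)] .
  obtain v where v: "v \<in> lists A" "y \<theta> = \<theta> `` {v}" using profinite_componentE[OF assms(2) *(1)] .
  have "x \<rho> = \<rho> `` {u}" "y \<rho> = \<rho> `` {v}"
    using profinite_component_mono[OF assms(1) * u] profinite_component_mono[OF assms(2) * v] .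
  then show "\<exists>w\<in>lists A. (x \<otimes>\<^bsub>free_profinite_monoid A\<^esub> y) \<theta> = \<theta> `` {w} \<and>
      (x \<otimes>\<^bsub>free_profinite_monoid A\<^esub> y) \<rho> = \<rho> `` {w}"
    using u v * by (intro bexI[of _ "u @ v"])
      (auto simp: profinite_mult_component quotient_monoid_mult finite_index_congruencesD)
qed

lemma profinite_one_mem: "\<one>\<^bsub>free_profinite_monoid A\<^esub> \<in> carrier (free_profinite_monoid A)"
  using profinite_word_mem[of "[]" A]
  by (simp add: profinite_word_def free_profinite_monoid_def)

lemma free_profinite_monoid_monoid: "monoid (free_profinite_monoid A)"
proof (rule monoidI)
  fix x y z
  assume x: "x \<in> carrier (free_profinite_monoid A)"
  have Q: "monoid (quotient_monoid A \<theta>)" if "\<theta> \<in> finite_index_congruences A" for \<theta>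
    using quotient_monoid_monoid finite_index_congruencesD(1)[OF that] by blast
  have c: "w \<theta> \<in> carrier (quotient_monoid A \<theta>)"
    if "w \<in> carrier (free_profinite_monoid A)" "\<theta> \<in> finite_index_congruences A" for w \<theta>
    using profinite_component[OF that] by simp
  show "\<one>\<^bsub>free_profinite_monoid A\<^esub> \<otimes>\<^bsub>free_profinite_monoid A\<^esub> x = x"
  proof (rule profinite_eqI[OF profinite_mult_mem[OF profinite_one_mem x] x])
    fix \<theta> assume \<theta>: "\<theta> \<in> finite_index_congruences A"
    show "(\<one>\<^bsub>free_profinite_monoid A\<^esub> \<otimes>\<^bsub>free_profinite_monoid A\<^esub> x) \<theta> = x \<theta>"
      unfolding profinite_mult_component[OF \<theta>] profinite_one_component[OF \<theta>]
      using monoid.l_one[OF Q[OF \<theta>] c[OF x \<theta>]] by simp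
  qed
  show "x \<otimes>\<^bsub>free_profinite_monoid A\<^esub> \<one>\<^bsub>free_profinite_monoid A\<^esub> = x"
  proof (rule profinite_eqI[OF profinite_mult_mem[OF x profinite_one_mem] x])
    fix \<theta> assume \<theta>: "\<theta> \<in> finite_index_congruences A"
    show "(x \<otimes>\<^bsub>free_profinite_monoid A\<^esub> \<one>\<^bsub>free_profinite_monoid A\<^esub>) \<theta> = x \<theta>"
      unfolding profinite_mult_component[OF \<theta>] profinite_one_component[OF \<theta>]
      using monoid.r_one[OF Q[OF \<theta>] c[OF x \<theta>]] by simp
  qed
  assume y: "y \<in> carrier (free_profinite_monoid A)"
  assume z: "z \<in> carrier (free_profinite_monoid A)"
  show "x \<otimes>\<^bsub>free_profinite_monoid A\<^esub> y \<otimes>\<^bsub>free_profinite_monoid A\<^esub> z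
      = x \<otimes>\<^bsub>free_profinite_monoid A\<^esub> (y \<otimes>\<^bsub>free_profinite_monoid A\<^esub> z)"
  proof (rule profinite_eqI)
    fix \<theta> assume \<theta>: "\<theta> \<in> finite_index_congruences A"
    show "(x \<otimes>\<^bsub>free_profinite_monoid A\<^esub> y \<otimes>\<^bsub>free_profinite_monoid A\<^esub> z) \<theta>
        = (x \<otimes>\<^bsub>free_profinite_monoid A\<^esub> (y \<otimes>\<^bsub>free_profinite_monoid A\<^esub> z)) \<theta>"
      unfolding profinite_mult_component[OF \<theta>]
      by (rule monoid.m_assoc[OF Q[OF \<theta>] c[OF x \<theta>] c[OF y \<theta>] c[OF z \<theta>]])
  qed (intro profinite_mult_mem x y z)+
qed (auto intro: profinite_mult_mem profinite_one_mem)

section \<open>Compactness and neighbourhoods in the projective limit\<close>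

abbreviation quotient_topology :: "'a set \<Rightarrow> 'a profinite topology" where
  "quotient_topology A \<equiv> product_topology
     (\<lambda>\<theta>. discrete_topology (carrier (quotient_monoid A \<theta>))) (finite_index_congruences A)"

lemma component_continuous:
  assumes "\<theta> \<in> finite_index_congruences A"
  shows "continuous_map (quotient_topology A) (discrete_topology (lists A // \<theta>)) (\<lambda>x. x \<theta>)"
  using continuous_map_product_projection[OF assms,
      of "\<lambda>\<theta>. discrete_topology (carrier (quotient_monoid A \<theta>))"] by simp

lemma closedin_component:
  assumes "\<theta> \<in> finite_index_congruences A"
  shows "closedin (quotient_topology A) {x \<in> topspace (quotient_topology A). P (x \<theta>)}"
proof -
  have "closedin (quotient_topology A)
      {x \<in> topspace (quotient_topology A). x \<theta> \<in> {c \<in> lists A // \<theta>. P c}}"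
    by (rule closedin_continuous_map_preimage[OF component_continuous[OF assms]]) auto
  also have "{x \<in> topspace (quotient_topology A). x \<theta> \<in> {c \<in> lists A // \<theta>. P c}}
      = {x \<in> topspace (quotient_topology A). P (x \<theta>)}"
    using assms by auto
  finally show ?thesis .
qed

text \<open>The coordinate at \<open>\<theta>\<close> has finitely many values, so any relation
  between two coordinates is a finite union of closed conditions. Applied to inclusion, it makes
  compatibility a closed condition.\<close>

lemma closedin_two_components:
  assumes "\<theta> \<in> finite_index_congruences A" "\<rho> \<in> finite_index_congruences A"
  shows "closedin (quotient_topology A) {x \<in> topspace (quotient_topology A). R (x \<theta>) (x \<rho>)}"
proof -
  have "{x \<in> topspace (quotient_topology A). R (x \<theta>) (x \<rho>)} = (\<Union>c\<in>lists A // \<theta>.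
      {x \<in> topspace (quotient_topology A). x \<theta> = c} \<inter> {x \<in> topspace (quotient_topology A). R c (x \<rho>)})"
    using assms by auto
  moreover have "closedin (quotient_topology A) \<dots>"
  proof (rule closedin_Union)
    show "finite ((\<lambda>c. {x \<in> topspace (quotient_topology A). x \<theta> = c} \<inter>
        {x \<in> topspace (quotient_topology A). R c (x \<rho>)}) ` (lists A // \<theta>))"
      using finite_index_congruencesD(2)[OF assms(1)] by simp
  next
    fix S assume "S \<in> (\<lambda>c. {x \<in> topspace (quotient_topology A). x \<theta> = c} \<inter>
        {x \<in> topspace (quotient_topology A). R c (x \<rho>)}) ` (lists A // \<theta>)"
    then obtain c where "S = {x \<in> topspace (quotient_topology A). x \<theta> = c} \<inter>
        {x \<in> topspace (quotient_topology A). R c (x \<rho>)}"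
      by (elim imageE)
    then show "closedin (quotient_topology A) S"
      using closedin_Int[OF closedin_component[OF assms(1)] closedin_component[OF assms(2)]] by simp
  qed
  ultimately show ?thesis by simp
qed

text \<open>Compactness as a gluing principle: properties solvable in every finite quotient, and
  inherited by coarser ones, have a common profinite solution. All profinite elements built later
  come from here.\<close>

lemma profinite_inverse_limit:
  assumes ne: "\<And>\<theta>. \<theta> \<in> finite_index_congruences A \<Longrightarrow> \<exists>u\<in>lists A. P \<theta> (\<theta> `` {u})"
    and mono: "\<And>\<theta> \<rho> u. \<theta> \<in> finite_index_congruences A \<Longrightarrow> \<rho> \<in> finite_index_congruences A \<Longrightarrow>
      \<theta> \<subseteq> \<rho> \<Longrightarrow> u \<in> lists A \<Longrightarrow> P \<theta> (\<theta> `` {u}) \<Longrightarrow> P \<rho> (\<rho> `` {u})"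
  shows "\<exists>x\<in>carrier (free_profinite_monoid A). \<forall>\<theta>\<in>finite_index_congruences A. P \<theta> (x \<theta>)"
proof -
  let ?I = "finite_index_congruences A" and ?X = "quotient_topology A"
  \<comment> \<open>Compatibility with everything coarser than \<open>\<theta>\<close> is part of
    the closed set, so that a point common to all these sets is automatically a compatible
    family.\<close>
  define E where "E \<theta> = {x \<in> topspace ?X. P \<theta> (x \<theta>)} \<inter>
      (\<Inter>\<rho>\<in>{\<rho>\<in>?I. \<theta> \<subseteq> \<rho>}. {x \<in> topspace ?X. x \<theta> \<subseteq> x \<rho>})" for \<theta>
  have closed: "\<forall>C\<in>E ` ?I. closedin ?X C"
  proof (rule ballI, erule imageE, hypsubst)
    fix \<theta> assume \<theta>: "\<theta> \<in> ?I"
    show "closedin ?X (E \<theta>)"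
      unfolding E_def
      using \<theta> by (intro closedin_Int closedin_Inter)
        (auto intro: closedin_component closedin_two_components
          simp del: topspace_product_topology quotient_monoid_simps)
  qed
  have "\<Inter>\<F> \<noteq> {}" if \<F>: "finite \<F>" "\<F> \<subseteq> E ` ?I" for \<F>
  proof -
    obtain T where T: "T \<subseteq> ?I" "finite T" "\<F> = E ` T"
      using finite_subset_image[OF \<F>] by blast
    then obtain \<theta> where \<theta>: "\<theta> \<in> ?I" "\<forall>\<rho>\<in>T. \<theta> \<subseteq> \<rho>"
      using finite_index_congruences_directed by blast
    then obtain u where u: "u \<in> lists A" "P \<theta> (\<theta> `` {u})"
      using ne by blast
    \<comment> \<open>A solution at a common refinement passes down to all of \<open>T\<close>, and
      the family of a single word is compatible.\<close>
    have "profinite_word A u \<in> E \<rho>" if "\<rho> \<in> T" for \<rho>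
      using T(1) that \<theta> mono[OF \<theta>(1) _ _ u] u(1)
      by (auto simp: E_def profinite_word_def intro!: quotientI)
    with T show ?thesis by blast
  qed
  then have fip: "\<forall>\<F>. finite \<F> \<and> \<F> \<subseteq> E ` ?I \<longrightarrow> \<Inter>\<F> \<noteq> {}"
    by blast
  have "compact_space ?X"
    using finite_index_congruencesD(2)
    by (auto simp: compact_space_product_topology compact_space_discrete_topology)
  from mp[OF spec[OF iffD1[OF compact_space_fip this]] conjI[OF closed fip]]
  have "\<Inter>(E ` ?I) \<noteq> {}" .
  then obtain x where x: "x \<in> E \<theta>" if "\<theta> \<in> ?I" for \<theta> by blast
  \<comment> \<open>The universal congruence provides at least one index, hence membership of
    \<open>x\<close> in the full product.\<close>
  then have "x \<in> (\<Pi>\<^sub>E \<theta>\<in>?I. lists A // \<theta>)"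
    using finite_index_congruences_top by (force simp: E_def)
  with x have "x \<in> carrier (free_profinite_monoid A)"
    by (auto simp: E_def free_profinite_monoid_def)
  with x show ?thesis by (auto simp: E_def)
qed

lemma topspace_profinite_topology [simp]:
  "topspace (profinite_topology A) = carrier (free_profinite_monoid A)"
  by (auto simp: profinite_topology_def free_profinite_monoid_def)

lemma openin_profinite_component:
  assumes "\<theta> \<in> finite_index_congruences A"
  shows "openin (profinite_topology A) {y \<in> carrier (free_profinite_monoid A). y \<theta> = c}"
proof -
  have "continuous_map (profinite_topology A) (discrete_topology (lists A // \<theta>)) (\<lambda>x. x \<theta>)"
    unfolding profinite_topology_def
    by (rule continuous_map_from_subtopology[OF component_continuous[OF assms]])
  then have "openin (profinite_topology A)
      {y \<in> topspace (profinite_topology A). y \<theta> \<in> {c} \<inter> lists A // \<theta>}"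
    by (rule openin_continuous_map_preimage) simp
  also have "{y \<in> topspace (profinite_topology A). y \<theta> \<in> {c} \<inter> lists A // \<theta>}
      = {y \<in> carrier (free_profinite_monoid A). y \<theta> = c}"
    using profinite_component[OF _ assms] by auto
  finally show ?thesis .
qed

text \<open>A basic open set restricts finitely many coordinates, and a common refinement determines
  all of them: conditions on one coordinate form a base.\<close>

lemma profinite_neighbourhood:
  assumes "openin (profinite_topology A) T" "x \<in> T"
  shows "\<exists>\<theta>\<in>finite_index_congruences A. \<forall>y\<in>carrier (free_profinite_monoid A). y \<theta> = x \<theta> \<longrightarrow> y \<in> T"
proof -
  let ?I = "finite_index_congruences A"
  obtain U where U: "openin (quotient_topology A) U" "T = U \<inter> carrier (free_profinite_monoid A)"
    using assms(1) unfolding profinite_topology_def openin_subtopology by blast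
  have x: "x \<in> U" "x \<in> carrier (free_profinite_monoid A)" using assms U by auto
  then obtain V where V: "finite {\<theta>\<in>?I. V \<theta> \<noteq> lists A // \<theta>}" "x \<in> Pi\<^sub>E ?I V" "Pi\<^sub>E ?I V \<subseteq> U"
    using U(1) unfolding openin_product_topology_alt by auto
  obtain \<theta> where \<theta>: "\<theta> \<in> ?I" "\<And>\<rho>. \<rho> \<in> ?I \<Longrightarrow> V \<rho> \<noteq> lists A // \<rho> \<Longrightarrow> \<theta> \<subseteq> \<rho>"
    using finite_index_congruences_directed[OF V(1)] by blast
  obtain u where u: "u \<in> lists A" "x \<theta> = \<theta> `` {u}" using profinite_componentE[OF x(2) \<theta>(1)] .
  have "y \<in> T" if y: "y \<in> carrier (free_profinite_monoid A)" "y \<theta> = x \<theta>" for y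
  proof -
    have "y \<rho> \<in> V \<rho>" if \<rho>: "\<rho> \<in> ?I" for \<rho>
    proof (cases "V \<rho> = lists A // \<rho>")
      case True
      then show ?thesis using profinite_component[OF y(1) \<rho>] by simp
    next
      case False
      then have "\<theta> \<subseteq> \<rho>" using \<theta>(2) \<rho> by blast
      then have "y \<rho> = x \<rho>"
        using profinite_component_mono[OF _ \<theta>(1) \<rho> _ u(1)] x(2) y u(2) by metis
      then show ?thesis using V(2) \<rho> by auto
    qed
    moreover have "y \<in> extensional ?I"
      using y(1) by (auto simp: free_profinite_monoid_def PiE_def)
    ultimately have "y \<in> Pi\<^sub>E ?I V" by (auto simp: PiE_def)
    with U V y show ?thesis by blast
  qed
  with \<theta>(1) show ?thesis by blast
qed

text \<open>Eliminates the topology: membership in a closure becomes a condition tested in one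
  finite quotient at a time.\<close>

lemma profinite_closure_iff:
  assumes "L \<subseteq> lists A"
  shows "x \<in> profinite_closure A L \<longleftrightarrow> x \<in> carrier (free_profinite_monoid A) \<and>
    (\<forall>\<theta>\<in>finite_index_congruences A. \<exists>u\<in>L. x \<theta> = \<theta> `` {u})"
proof (intro iffI conjI ballI)
  assume x: "x \<in> profinite_closure A L"
  then show xc: "x \<in> carrier (free_profinite_monoid A)"
    by (auto simp: profinite_closure_def in_closure_of)
  fix \<theta> assume \<theta>: "\<theta> \<in> finite_index_congruences A"
  have "\<forall>T. x \<in> T \<and> openin (profinite_topology A) T \<longrightarrow> (\<exists>y. y \<in> profinite_word A ` L \<and> y \<in> T)"
    using x unfolding profinite_closure_def in_closure_of by (rule conjunct2)
  from this[THEN spec, THEN mp, OF conjI[OF _ openin_profinite_component[OF \<theta>, of "x \<theta>"]]] xc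
  obtain u where "u \<in> L" "profinite_word A u \<theta> = x \<theta>" by auto
  then have "x \<theta> = \<theta> `` {u}" using profinite_word_component[OF \<theta>] by metis
  with \<open>u \<in> L\<close> show "\<exists>u\<in>L. x \<theta> = \<theta> `` {u}" by blast
next
  assume x: "x \<in> carrier (free_profinite_monoid A) \<and>
    (\<forall>\<theta>\<in>finite_index_congruences A. \<exists>u\<in>L. x \<theta> = \<theta> `` {u})"
  show "x \<in> profinite_closure A L"
    unfolding profinite_closure_def in_closure_of
  proof (intro conjI allI impI)
    show "x \<in> topspace (profinite_topology A)" using x by simp
    fix T assume "x \<in> T \<and> openin (profinite_topology A) T"
    then obtain \<theta> where \<theta>: "\<theta> \<in> finite_index_congruences A"
      and T: "\<forall>y\<in>carrier (free_profinite_monoid A). y \<theta> = x \<theta> \<longrightarrow> y \<in> T"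
      using profinite_neighbourhood by blast
    obtain u where u: "u \<in> L" "x \<theta> = \<theta> `` {u}" using x \<theta> by blast
    from u assms have "u \<in> lists A" by blast
    then have "profinite_word A u \<in> T"
      using T[rule_format, OF profinite_word_mem] u(2) profinite_word_component[OF \<theta>, of u] by simp
    with u show "\<exists>y. y \<in> profinite_word A ` L \<and> y \<in> T" by blast
  qed
qed

text \<open>The congruence of \<open>L\<close> is itself an index of the projective limit, so the
  continuous extension is the projection to that coordinate. Uniqueness follows from density of the
  words.\<close>

lemma syntactic_ext_component:
  assumes "syntactic_congruence A L \<in> finite_index_congruences A"
    and x: "x \<in> carrier (free_profinite_monoid A)"
  shows "syntactic_ext A L x = x (syntactic_congruence A L)"
proof -
  let ?\<theta> = "syntactic_congruence A L"
  let ?C = "carrier (free_profinite_monoid A)"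
  let ?D = "discrete_topology (carrier (syntactic_monoid A L))"
  let ?h = "\<lambda>x\<in>?C. x ?\<theta>"
  have "syntactic_ext A L = ?h"
    unfolding syntactic_ext_def
  proof (rule the_equality)
    have "continuous_map (profinite_topology A) ?D (\<lambda>x. x ?\<theta>)"
      unfolding profinite_topology_def syntactic_monoid_def
      using continuous_map_from_subtopology[OF component_continuous[OF assms(1)]] by simp
    then have "continuous_map (profinite_topology A) ?D ?h"
      by (rule continuous_map_eq) simp
    moreover have "?h (profinite_word A u) = syntactic_hom A L u" if "u \<in> lists A" for u
      using profinite_word_mem[OF that] profinite_word_component[OF assms(1)]
      by (simp add: syntactic_hom_def)
    ultimately show "?h \<in> extensional ?C \<and> continuous_map (profinite_topology A) ?D ?h \<and>
        (\<forall>u\<in>lists A. ?h (profinite_word A u) = syntactic_hom A L u)"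
      by (intro conjI ballI) auto
  next
    fix h
    assume h: "h \<in> extensional ?C \<and> continuous_map (profinite_topology A) ?D h \<and>
        (\<forall>u\<in>lists A. h (profinite_word A u) = syntactic_hom A L u)"
    show "h = ?h"
    proof (rule extensionalityI)
      show "h \<in> extensional ?C" using h by blast
      fix y assume y: "y \<in> ?C"
      \<comment> \<open>Both \<open>h\<close> and the projection are locally constant; a word close
        to \<open>y\<close> has the values of \<open>y\<close> under both, and on words they
        agree.\<close>
      have "openin (profinite_topology A) {z \<in> topspace (profinite_topology A). h z \<in> {h y}}"
        using h y by (intro openin_continuous_map_preimage[of _ ?D h])
          (auto simp: continuous_map_def Pi_iff)
      then have open_T: "openin (profinite_topology A)
          ({z \<in> topspace (profinite_topology A). h z \<in> {h y}} \<inter> {z \<in> ?C. z ?\<theta> = y ?\<theta>})"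
        (is "openin _ ?T")
        by (rule openin_Int[OF _ openin_profinite_component[OF assms(1)]])
      have "y \<in> ?T" using y by simp
      from profinite_neighbourhood[OF open_T this] obtain \<rho>
        where \<rho>: "\<rho> \<in> finite_index_congruences A" "\<forall>z\<in>?C. z \<rho> = y \<rho> \<longrightarrow> z \<in> ?T"
        by (elim bexE)
      obtain u where u: "u \<in> lists A" "y \<rho> = \<rho> `` {u}" using profinite_componentE[OF y \<rho>(1)] .
      then have "profinite_word A u \<rho> = y \<rho>"
        using profinite_word_component[OF \<rho>(1)] by simp
      then have "profinite_word A u \<in> ?T"
        by (rule mp[OF bspec[OF \<rho>(2) profinite_word_mem[OF u(1)]]])
      then have "h y = h (profinite_word A u)" "y ?\<theta> = profinite_word A u ?\<theta>" by simp_all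
      moreover have "h (profinite_word A u) = syntactic_hom A L u" using h u(1) by blast
      ultimately show "h y = ?h y"
        using y profinite_word_component[OF assms(1)] by (simp add: syntactic_hom_def)
    qed simp
  qed
  then show ?thesis using x by simp
qed

section \<open>Finite monoids\<close>

lemma (in monoid) idempotent_power:
  assumes "finite (carrier G)" "x \<in> carrier G"
  obtains n :: nat where "2 \<le> n" "x [^] n \<otimes> x [^] n = x [^] n"
proof -
  have "\<not> inj_on (\<lambda>n::nat. x [^] n) UNIV"
  proof
    assume "inj_on (\<lambda>n::nat. x [^] n) UNIV"
    moreover have "range (\<lambda>n::nat. x [^] n) \<subseteq> carrier G" using assms(2) by auto
    ultimately have "finite (UNIV :: nat set)"
      using assms(1) by (meson finite_subset finite_imageD)
    then show False by simp
  qed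
  then obtain i j :: nat where ij: "i < j" "x [^] i = x [^] j"
    using linorder_injI[of "\<lambda>n::nat. x [^] n"] by blast
  define p where "p = j - i"
  have p: "0 < p" "x [^] (i + p) = x [^] i" using ij by (simp_all add: p_def)
  have step: "x [^] (m + p) = x [^] m" if "i \<le> m" for m
  proof -
    define d where "d = m - i"
    with that have "m = d + i" by simp
    then have "x [^] (m + p) = x [^] d \<otimes> x [^] (i + p)"
      using assms(2) by (simp add: nat_pow_mult add.assoc)
    also have "\<dots> = x [^] m"
      using p(2) \<open>m = d + i\<close> assms(2) by (simp add: nat_pow_mult)
    finally show ?thesis .
  qed
  have steps: "x [^] (m + k * p) = x [^] m" if "i \<le> m" for m k
  proof (induction k)
    case (Suc k)
    then show ?case using step[of "m + k * p"] that by (simp add: algebra_simps)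
  qed simp
  \<comment> \<open>A multiple of the period \<open>p\<close> beyond the preperiod \<open>i\<close>.
    The summand 2 ensures an exponent of at least 2, which allows a factor to be split off
    twice.\<close>
  let ?n = "(i + 2) * p"
  have "i + 2 \<le> ?n" using p(1) by (cases p) auto
  moreover from this have "x [^] ?n \<otimes> x [^] ?n = x [^] ?n"
    using steps[of ?n "i + 2"] assms(2) nat_pow_mult[OF assms(2), of ?n ?n] by simp
  ultimately show ?thesis using that[of ?n] by simp
qed

text \<open>From e = a h b and c = h b one gets e = a e c, and iterating, e = a^k e c^k. At an
  exponent where c^n is idempotent, right multiplication by c^n fixes e. Since e c = c, the product
  e c^n is c^n, which begins with h.\<close>

lemma (in monoid) R_stability:
  assumes "finite (carrier G)" "e \<in> carrier G" "h \<in> carrier G" "e \<otimes> h = h" "J_le G e h"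
  shows "R_le G e h"
proof -
  obtain a b where ab: "a \<in> carrier G" "b \<in> carrier G" "e = a \<otimes> h \<otimes> b"
    using assms(5) unfolding J_le_def by blast
  define c where "c = h \<otimes> b"
  have c: "c \<in> carrier G" "e \<otimes> c = c" "e = a \<otimes> e \<otimes> c"
    using assms(2,3) ab(1,2) unfolding c_def
    by (simp, metis assms(4) m_assoc, metis ab(3) assms(4) m_assoc m_closed)
  have power: "e = a [^] k \<otimes> e \<otimes> c [^] k" for k :: nat
  proof (induction k)
    case (Suc k)
    have "a [^] Suc k \<otimes> e \<otimes> c [^] Suc k = a [^] k \<otimes> (a \<otimes> e \<otimes> c) \<otimes> c [^] k"
      using ab(1) c(1) assms(2) nat_pow_Suc2[OF c(1)] by (simp add: m_assoc)
    with Suc c(3) show ?case by simp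
  qed (use assms(2) in simp)
  obtain n :: nat where n: "2 \<le> n" "c [^] n \<otimes> c [^] n = c [^] n"
    using idempotent_power[OF assms(1) c(1)] .
  have "e \<otimes> c [^] n = a [^] n \<otimes> e \<otimes> (c [^] n \<otimes> c [^] n)"
    using power[of n] ab(1) c(1) assms(2) by (metis m_assoc m_closed nat_pow_closed)
  then have "e = e \<otimes> c [^] n" using power[of n] n(2) by simp
  also obtain m where "n = Suc m" using n(1) by (cases n) auto
  then have "e \<otimes> c [^] n = e \<otimes> c \<otimes> c [^] m"
    using nat_pow_Suc2[OF c(1)] assms(2) c(1) by (simp add: m_assoc)
  also have "\<dots> = h \<otimes> (b \<otimes> c [^] m)"
    using c(1,2) assms(3) ab(2) by (simp add: c_def m_assoc)
  finally show ?thesis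
    unfolding R_le_def using ab(2) c(1) by (metis m_closed nat_pow_closed)
qed

text \<open>Left-right dual of \<open>R_stability\<close>, with c = a h.\<close>

lemma (in monoid) L_stability:
  assumes "finite (carrier G)" "e \<in> carrier G" "h \<in> carrier G" "h \<otimes> e = h" "J_le G e h"
  shows "L_le G e h"
proof -
  obtain a b where ab: "a \<in> carrier G" "b \<in> carrier G" "e = a \<otimes> h \<otimes> b"
    using assms(5) unfolding J_le_def by blast
  define c where "c = a \<otimes> h"
  have c: "c \<in> carrier G" "c \<otimes> e = c" "e = c \<otimes> e \<otimes> b"
    using assms(2,3) ab(1,2) unfolding c_def
    by (simp, metis assms(4) m_assoc, metis ab(3) assms(4) m_assoc m_closed)
  have power: "e = c [^] k \<otimes> e \<otimes> b [^] k" for k :: nat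
  proof (induction k)
    case (Suc k)
    have "c [^] Suc k \<otimes> e \<otimes> b [^] Suc k = c [^] k \<otimes> (c \<otimes> e \<otimes> b) \<otimes> b [^] k"
      using ab(2) c(1) assms(2) nat_pow_Suc2[OF ab(2)] by (simp add: m_assoc)
    with Suc c(3) show ?case by simp
  qed (use assms(2) in simp)
  obtain n :: nat where n: "2 \<le> n" "c [^] n \<otimes> c [^] n = c [^] n"
    using idempotent_power[OF assms(1) c(1)] .
  have "c [^] n \<otimes> e = (c [^] n \<otimes> c [^] n) \<otimes> e \<otimes> b [^] n"
    using power[of n] ab(2) c(1) assms(2) by (metis m_assoc m_closed nat_pow_closed)
  then have "e = c [^] n \<otimes> e" using power[of n] n(2) by simp
  also obtain m where "n = Suc m" using n(1) by (cases n) auto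
  then have "c [^] n \<otimes> e = c [^] m \<otimes> (c \<otimes> e)"
    using assms(2) c(1) by (simp add: m_assoc)
  also have "\<dots> = c [^] m \<otimes> a \<otimes> h"
    using c(1,2) assms(3) ab(1) by (simp add: c_def m_assoc)
  finally show ?thesis
    unfolding L_le_def using ab(1) c(1) by (metis m_closed nat_pow_closed)
qed

section \<open>Idempotents passing through an H-class of the minimum ideal\<close>

lemma (in monoid) minimum_ideal_J_le:
  assumes "e \<in> minimum_ideal G" "h \<in> carrier G"
  shows "J_le G e h"
proof -
  have "monoid_ideal G {s \<otimes> h \<otimes> t | s t. s \<in> carrier G \<and> t \<in> carrier G}" (is "monoid_ideal G ?I")
    unfolding monoid_ideal_def
  proof (intro conjI ballI)
    have "\<one> \<otimes> h \<otimes> \<one> \<in> ?I" by blast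
    then show "?I \<noteq> {}" by blast
  next
    fix x u assume "x \<in> ?I" and u: "u \<in> carrier G"
    then obtain s t where st: "s \<in> carrier G" "t \<in> carrier G" "x = s \<otimes> h \<otimes> t" by blast
    then have "u \<otimes> x = (u \<otimes> s) \<otimes> h \<otimes> t" "x \<otimes> u = s \<otimes> h \<otimes> (t \<otimes> u)"
      using u assms(2) by (simp_all add: m_assoc)
    with st u show "u \<otimes> x \<in> ?I" "x \<otimes> u \<in> ?I" by (metis (mono_tags, lifting) m_closed mem_Collect_eq)+
  qed (use assms(2) in auto)
  then have "e \<in> ?I" using assms(1) unfolding minimum_ideal_def by blast
  then show ?thesis unfolding J_le_def by blast
qed

lemma (in monoid) power_conjugate:
  fixes n :: nat
  assumes "x \<in> carrier G" "y \<in> carrier G"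
  shows "x \<otimes> (y \<otimes> x) [^] n \<otimes> y = (x \<otimes> y) [^] Suc n"
proof (induction n)
  case (Suc n)
  have "x \<otimes> (y \<otimes> x) [^] Suc n \<otimes> y = (x \<otimes> (y \<otimes> x) [^] n \<otimes> y) \<otimes> (x \<otimes> y)"
    using assms by (simp add: m_assoc)
  then show ?case using Suc assms by simp
qed (use assms in simp)

text \<open>The witness is \<open>(r a)\<^sup>n\<^sup>-\<^sup>1 e\<close>, where \<open>n\<close> is an idempotent exponent of \<open>a r\<close>.\<close>

lemma (in monoid) minimum_ideal_H_class_idempotent:
  assumes fin: "finite (carrier G)"
    and e: "e \<in> minimum_ideal G" "e \<in> carrier G" "e \<otimes> e = e"
    and a: "a \<in> carrier G" and r: "r \<in> carrier G" "e \<otimes> r = r"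
  obtains h where "(e, h) \<in> H_rel G" "(a \<otimes> h \<otimes> r) \<otimes> (a \<otimes> h \<otimes> r) = a \<otimes> h \<otimes> r"
proof -
  obtain n :: nat where n: "2 \<le> n" "(a \<otimes> r) [^] n \<otimes> (a \<otimes> r) [^] n = (a \<otimes> r) [^] n"
    using idempotent_power[OF fin m_closed[OF a r(1)]] .
  define m where "m = n - 2"
  with n(1) have m: "n = Suc (Suc m)" by simp
  \<comment> \<open>The exponent is n - 1, at least 1, so \<open>h\<close> begins with
    \<open>r\<close> and absorbs \<open>e\<close> on the left; the final factor \<open>e\<close>
    does the same on the right.\<close>
  define h where "h = (r \<otimes> a) [^] Suc m \<otimes> e"
  have h: "h \<in> carrier G" using a r e by (simp add: h_def)
  have eh: "e \<otimes> h = h"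
  proof -
    have "h = r \<otimes> (a \<otimes> (r \<otimes> a) [^] m \<otimes> e)"
      unfolding h_def using nat_pow_Suc2[OF m_closed[OF r(1) a]] a r(1) e(2) by (simp add: m_assoc)
    moreover have "e \<otimes> (r \<otimes> (a \<otimes> (r \<otimes> a) [^] m \<otimes> e)) = e \<otimes> r \<otimes> (a \<otimes> (r \<otimes> a) [^] m \<otimes> e)"
      using a r(1) e(2) by (simp add: m_assoc)
    ultimately show ?thesis using r(2) by simp
  qed
  have he: "h \<otimes> e = h"
    using a r(1) e(2,3) by (simp add: h_def m_assoc)
  \<comment> \<open>Minimality places \<open>e\<close> J-below \<open>h\<close>; stability refines
    this to the one-sided orders.\<close>
  have "R_le G e h" "L_le G e h"
    using R_stability[OF fin e(2) h eh] L_stability[OF fin e(2) h he] minimum_ideal_J_le[OF e(1) h]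
    by blast+
  moreover have "R_le G h e" "L_le G h e"
    unfolding R_le_def L_le_def using eh he h by (metis, metis)
  ultimately have "(e, h) \<in> H_rel G"
    using e(2) h by (simp add: H_rel_def R_rel_def L_rel_def)
  \<comment> \<open>As e r = r, the factor \<open>e\<close> disappears and a (r a)^(n-1) r regroups
    as (a r)^n.\<close>
  moreover have "a \<otimes> h \<otimes> r = (a \<otimes> r) [^] n"
  proof -
    have "a \<otimes> h \<otimes> r = a \<otimes> (r \<otimes> a) [^] Suc m \<otimes> (e \<otimes> r)"
      using a r(1) e(2) unfolding h_def by (simp add: m_assoc)
    then show ?thesis using power_conjugate[OF a r(1), of "Suc m"] r(2) m by simp
  qed
  then have "(a \<otimes> h \<otimes> r) \<otimes> (a \<otimes> h \<otimes> r) = a \<otimes> h \<otimes> r"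
    using n(2) by argo
  ultimately show ?thesis by (rule that)
qed

lemma (in monoid) H_rel_trans:
  assumes "(x, y) \<in> H_rel G" "(y, z) \<in> H_rel G"
  shows "(x, z) \<in> H_rel G"
proof -
  have c: "x \<in> carrier G" "y \<in> carrier G" "z \<in> carrier G"
    using assms by (auto simp: H_rel_def R_rel_def)
  have R: "R_le G s u" if "R_le G s t" "R_le G t u" "u \<in> carrier G" for s t u
    using that unfolding R_le_def by (metis m_assoc m_closed)
  have L: "L_le G s u" if "L_le G s t" "L_le G t u" "u \<in> carrier G" for s t u
    using that unfolding L_le_def by (metis m_assoc m_closed)
  have "R_le G x y" "R_le G y x" "L_le G x y" "L_le G y x" "R_le G y z" "R_le G z y" "L_le G y z" "L_le G z y"
    using assms by (auto simp: H_rel_def R_rel_def L_rel_def)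
  then have "R_le G x z" "R_le G z x" "L_le G x z" "L_le G z x"
    using R L c by blast+
  with c show ?thesis by (simp add: H_rel_def R_rel_def L_rel_def)
qed

lemma (in monoid) H_rel_refl:
  assumes "x \<in> carrier G"
  shows "(x, x) \<in> H_rel G"
proof -
  have "R_le G x x" "L_le G x x"
    unfolding R_le_def L_le_def using assms by (intro bexI[OF _ one_closed]; simp)+
  with assms show ?thesis by (simp add: H_rel_def R_rel_def L_rel_def)
qed

lemma (in monoid) maximal_subgroup_H_class:
  assumes "maximal_subgroup G K" "x \<in> K" "(x, y) \<in> H_rel G"
  shows "y \<in> K"
proof -
  obtain c where "K = H_rel G `` {c}"
    using assms(1) unfolding maximal_subgroup_def by (auto elim: quotientE)
  with assms(2,3) show ?thesis using H_rel_trans by auto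
qed

section \<open>Bifix codes\<close>

text \<open>Parsing from the left is deterministic: two initial code words of the same word are
  prefix-comparable, hence equal. This is what makes the submonoid unitary, letting code factors be
  cancelled on the left.\<close>

lemma prefix_code_parse:
  assumes "[] \<notin> Z" "\<forall>x\<in>Z. \<forall>y\<in>Z. \<not> strict_prefix x y"
    and "us \<in> lists Z" "ws \<in> lists Z" "concat us @ v = concat ws"
  shows "\<exists>vs. ws = us @ vs \<and> v = concat vs"
  using assms(3-5)
proof (induction us arbitrary: ws rule: list.induct)
  case (Cons u us)
  have uZ: "u \<in> Z" "us \<in> lists Z" using Cons.prems(1) by auto
  then have "u \<noteq> []" using assms(1) by auto
  then obtain w ws' where ws: "ws = w # ws'" using Cons.prems(3) by (cases ws) auto
  then have w: "w \<in> Z" "ws' \<in> lists Z" using Cons.prems(2) by auto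
  have eq: "u @ (concat us @ v) = w @ concat ws'" using Cons.prems(3) ws by simp
  then have "prefix u w \<or> prefix w u"
    by (metis prefixI prefix_same_cases)
  then have "u = w"
    using assms(2) uZ(1) w(1) by (auto simp: strict_prefix_def)
  with eq have "concat us @ v = concat ws'" by simp
  from Cons.IH[OF uZ(2) w(2) this] obtain vs where "ws' = us @ vs \<and> v = concat vs" ..
  with ws \<open>u = w\<close> show ?case by simp
qed simp

text \<open>The dual statement, parsing from the right.\<close>

lemma suffix_code_parse:
  assumes "[] \<notin> Z" "\<forall>x\<in>Z. \<forall>y\<in>Z. \<not> strict_suffix x y"
    and "us \<in> lists Z" "ws \<in> lists Z" "v @ concat us = concat ws"
  shows "\<exists>vs. ws = vs @ us \<and> v = concat vs"
  using assms(3-5)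
proof (induction us arbitrary: ws rule: rev_induct)
  case (snoc u us)
  have uZ: "u \<in> Z" "us \<in> lists Z" using snoc.prems(1) by auto
  then have "u \<noteq> []" using assms(1) by auto
  then obtain ws' w where ws: "ws = ws' @ [w]" using snoc.prems(3) by (cases ws rule: rev_cases) auto
  then have w: "w \<in> Z" "ws' \<in> lists Z" using snoc.prems(2) by auto
  have eq: "(v @ concat us) @ u = concat ws' @ w" using snoc.prems(3) ws by simp
  then have "suffix u w \<or> suffix w u"
    by (metis suffixI suffix_same_cases)
  then have "u = w"
    using assms(2) uZ(1) w(1) by (auto simp: strict_suffix_def)
  with eq have "v @ concat us = concat ws'" by simp
  from snoc.IH[OF uZ(2) w(2) this] obtain vs where "ws' = vs @ us \<and> v = concat vs" ..
  with ws \<open>u = w\<close> show ?case by simp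
qed simp

lemma bifix_codeD:
  assumes "bifix_code A Z"
  shows "[] \<notin> Z" "Z \<subseteq> lists A" "\<forall>x\<in>Z. \<forall>y\<in>Z. \<not> strict_prefix x y"
    "\<forall>x\<in>Z. \<forall>y\<in>Z. \<not> strict_suffix x y"
  using assms unfolding bifix_code_def code_def by blast+

lemma generated_submonoidE:
  assumes "w \<in> generated_submonoid Z"
  obtains ws where "ws \<in> lists Z" "w = concat ws"
  using assms unfolding generated_submonoid_def by (elim imageE)

text \<open>Completeness extends \<open>v\<close> to a word w = v t of the submonoid. Idempotence
  turns this into v v t = v w, also in the submonoid, and the suffix property cancels
  \<open>w\<close>.\<close>

lemma idempotent_class_in_submonoid:
  assumes "rational A Z" "bifix_code A Z" "complete_code A Z" "v \<in> lists A"
    and idem: "(v @ v, v) \<in> syntactic_congruence A (generated_submonoid Z)"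
  shows "v \<in> generated_submonoid Z"
proof -
  note Z = bifix_codeD[OF assms(2)]
  obtain w where w: "w \<in> generated_submonoid Z" "prefix v w"
    using assms(3,4) unfolding complete_code_def covers_def by blast
  then obtain t where t: "w = v @ t" by (auto elim: prefixE)
  have "w \<in> lists A" using rational_subset[OF rational.star[OF assms(1)]] w(1) by blast
  then have "t \<in> lists A" using t by simp
  then have "[] @ (v @ v) @ t \<in> generated_submonoid Z \<longleftrightarrow> [] @ v @ t \<in> generated_submonoid Z"
    using idem unfolding syntactic_congruence_def by blast
  then have "v @ w \<in> generated_submonoid Z" using w(1) t by simp
  then obtain us ws where "us \<in> lists Z" "w = concat us" "ws \<in> lists Z" "v @ w = concat ws"
    using w(1) by (metis generated_submonoidE)
  with suffix_code_parse[OF Z(1,4), of us ws v] obtain vs where "ws = vs @ us" "v = concat vs" by auto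
  with \<open>ws \<in> lists Z\<close> show ?thesis by (auto simp: generated_submonoid_def)
qed

section \<open>Subshift languages and their profinite closures\<close>

lemma subshift_languageD:
  assumes "subshift_language A F"
  shows "F \<subseteq> lists A" "[] \<in> F" "\<And>u w. w \<in> F \<Longrightarrow> sublist u w \<Longrightarrow> u \<in> F"
    "\<And>u. u \<in> F \<Longrightarrow> \<exists>a\<in>A. a # u \<in> F" "\<And>u. u \<in> F \<Longrightarrow> \<exists>b\<in>A. u @ [b] \<in> F"
proof -
  show "F \<subseteq> lists A" "\<And>u w. w \<in> F \<Longrightarrow> sublist u w \<Longrightarrow> u \<in> F"
    "\<And>u. u \<in> F \<Longrightarrow> \<exists>a\<in>A. a # u \<in> F" "\<And>u. u \<in> F \<Longrightarrow> \<exists>b\<in>A. u @ [b] \<in> F"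
    using assms unfolding subshift_language_def by blast+
  obtain w where "w \<in> F" using assms unfolding subshift_language_def by blast
  then show "[] \<in> F" using assms unfolding subshift_language_def by blast
qed

lemma subshift_extend_right:
  assumes "subshift_language A F" "u \<in> F"
  shows "\<exists>v. length v = n \<and> u @ v \<in> F"
proof (induction n)
  case (Suc n)
  then obtain v where v: "length v = n" "u @ v \<in> F" by blast
  from subshift_languageD(5)[OF assms(1) v(2)] obtain b where "(u @ v) @ [b] \<in> F" by blast
  with v(1) show ?case by (intro exI[of _ "v @ [b]"]) simp
qed (use assms in simp)

lemma subshift_extend_left:
  assumes "subshift_language A F" "u \<in> F"
  shows "\<exists>v. length v = n \<and> v @ u \<in> F"
proof (induction n)
  case (Suc n)
  then obtain v where v: "length v = n" "v @ u \<in> F" by blast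
  from subshift_languageD(4)[OF assms(1) v(2)] obtain a where "a # (v @ u) \<in> F" by blast
  with v(1) show ?case by (intro exI[of _ "a # v"]) simp
qed (use assms in simp)

text \<open>Prolongability to the right, iterated from the empty word; factoriality covers the
  factors not at the start. The positions of this word are what Ramsey's theorem is applied
  to.\<close>

lemma subshift_infinite_word:
  assumes "subshift_language A F"
  obtains f :: "nat \<Rightarrow> 'a" where "\<And>i j. map f [i..<j] \<in> F"
proof -
  define g where "g = rec_nat [] (\<lambda>_ u. u @ [SOME b. u @ [b] \<in> F])"
  have g_Suc: "g (Suc n) = g n @ [SOME b. g n @ [b] \<in> F]" for n by (simp add: g_def)
  have g: "g n \<in> F" for n
  proof (induction n)
    case 0
    then show ?case using subshift_languageD(2)[OF assms] by (simp add: g_def)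
  next
    case (Suc n)
    then have "\<exists>b. g n @ [b] \<in> F" using subshift_languageD(5)[OF assms] by blast
    then show ?case unfolding g_Suc by (rule someI_ex)
  qed
  define f where "f n = (SOME b. g n @ [b] \<in> F)" for n
  have "g n = map f [0..<n]" for n
    by (induction n) (simp_all add: g_Suc f_def, simp add: g_def)
  then have initial: "map f [0..<n] \<in> F" for n using g[of n] by simp
  have "map f [i..<j] \<in> F" for i j
  proof (cases "i \<le> j")
    case True
    then have "map f [0..<j] = map f [0..<i] @ map f [i..<j]"
      using upt_add_eq_append[of 0 i "j - i"] by simp
    then have "sublist (map f [i..<j]) (map f [0..<j])" by simp
    then show ?thesis using subshift_languageD(3)[OF assms initial] by blast
  next
    \<comment> \<open>An empty interval gives the empty word.\<close>
    case False
    then show ?thesis using subshift_languageD(2)[OF assms] by simp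
  qed
  then show ?thesis by (rule that)
qed

text \<open>Colour a pair of positions by the class of the factor between them. On an infinite
  monochromatic set, adjacent factors and their concatenation share one class, which is therefore
  idempotent; distant positions give long representatives.\<close>

lemma subshift_idempotent_class:
  assumes "subshift_language A F" "\<theta> \<in> finite_index_congruences A"
  obtains u where "u \<in> lists A" "(u @ u, u) \<in> \<theta>" "\<And>n. \<exists>v\<in>F. n \<le> length v \<and> \<theta> `` {u} = \<theta> `` {v}"
proof -
  note \<theta> = finite_index_congruencesD[OF assms(2)]
  obtain f :: "nat \<Rightarrow> 'a" where f: "map f [i..<j] \<in> F" for i j
    using subshift_infinite_word[OF assms(1)] by blast
  have f_lists: "map f [i..<j] \<in> lists A" for i j
    using f subshift_languageD(1)[OF assms(1)] by blast
  obtain c :: "'a list set \<Rightarrow> nat" and k where c: "c ` (lists A // \<theta>) = {i. i < k}" "inj_on c (lists A // \<theta>)"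
    using finite_imp_inj_to_nat_seg[OF \<theta>(2)] by auto
  \<comment> \<open>Pairs are unordered sets and colours are numbers, hence minimum, maximum and the
    numbering \<open>c\<close> of the classes.\<close>
  define col where "col S = c (\<theta> `` {map f [Min S..<Max S]})" for S
  have "col S < k" for S
    using c(1) quotientI[OF f_lists, of \<theta> "Min S" "Max S"] unfolding col_def by blast
  then have "\<forall>x\<in>UNIV. \<forall>y\<in>UNIV. x \<noteq> y \<longrightarrow> col {x, y} < k" by blast
  from Ramsey2[OF infinite_UNIV_nat this] obtain Y t where
    "infinite Y" and Y: "\<forall>x\<in>Y. \<forall>y\<in>Y. x \<noteq> y \<longrightarrow> col {x, y} = t" by (elim exE conjE)
  have Y_unbounded: "\<exists>j\<in>Y. n \<le> j" for n
    using \<open>infinite Y\<close> unfolding infinite_nat_iff_unbounded_le by blast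
  have same: "\<theta> `` {map f [i..<j]} = \<theta> `` {map f [i'..<j']}"
    if "i \<in> Y" "j \<in> Y" "i < j" "i' \<in> Y" "j' \<in> Y" "i' < j'" for i j i' j'
  proof -
    have "c (\<theta> `` {map f [i..<j]}) = c (\<theta> `` {map f [i'..<j']})"
      using Y[rule_format, of i j] Y[rule_format, of i' j'] that by (simp add: col_def)
    then show ?thesis
      using inj_onD[OF c(2)] quotientI[OF f_lists] by blast
  qed
  obtain i where i: "i \<in> Y" using Y_unbounded by blast
  obtain j where j: "j \<in> Y" "i < j" using Y_unbounded[of "Suc i"] by auto
  obtain l where l: "l \<in> Y" "j < l" using Y_unbounded[of "Suc j"] by auto
  let ?u = "map f [i..<j]"
  show ?thesis
  proof
    show "?u \<in> lists A" by (rule f_lists)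
    have "(?u, map f [j..<l]) \<in> \<theta>"
      using same[OF i j j(1) l] word_congruence_class_eq[OF \<theta>(1) f_lists f_lists] by blast
    then have "(?u @ ?u, ?u @ map f [j..<l]) \<in> \<theta>"
      using word_congruence_append[OF \<theta>(1) word_congruence_refl[OF \<theta>(1) f_lists]] by blast
    moreover have "?u @ map f [j..<l] = map f [i..<l]"
      using upt_add_eq_append[of i j "l - j"] j l by simp
    moreover have "(map f [i..<l], ?u) \<in> \<theta>"
      using same[OF i l(1) _ i j] j l word_congruence_class_eq[OF \<theta>(1) f_lists f_lists] by force
    ultimately show "(?u @ ?u, ?u) \<in> \<theta>"
      using word_congruence_trans[OF \<theta>(1)] by metis
    show "\<exists>v\<in>F. n \<le> length v \<and> \<theta> `` {?u} = \<theta> `` {v}" for n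
    proof -
      obtain m where m: "m \<in> Y" "i + Suc n \<le> m" using Y_unbounded by blast
      then have "\<theta> `` {?u} = \<theta> `` {map f [i..<m]}" using same[OF i j i m(1)] by simp
      with m(2) show ?thesis by (intro bexI[OF _ f[of i m]]) simp
    qed
  qed
qed

text \<open>Idempotence and unbounded representatives are put into one predicate, because they must
  hold for the same limit; both survive coarsening.\<close>

lemma subshift_infinite_idempotent:
  assumes "subshift_language A F"
  obtains e where "e \<in> carrier (free_profinite_monoid A)" "e \<otimes>\<^bsub>free_profinite_monoid A\<^esub> e = e"
    "\<And>\<theta> n. \<theta> \<in> finite_index_congruences A \<Longrightarrow> \<exists>v\<in>F. n \<le> length v \<and> e \<theta> = \<theta> `` {v}"
proof -
  let ?P = "\<lambda>\<theta> c. c \<otimes>\<^bsub>quotient_monoid A \<theta>\<^esub> c = c \<and> (\<forall>n. \<exists>v\<in>F. n \<le> length v \<and> c = \<theta> `` {v})"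
  have P_iff: "?P \<theta> (\<theta> `` {u}) \<longleftrightarrow> (u @ u, u) \<in> \<theta> \<and> (\<forall>n. \<exists>v\<in>F. n \<le> length v \<and> (u, v) \<in> \<theta>)"
    if \<theta>: "\<theta> \<in> finite_index_congruences A" and u: "u \<in> lists A" for \<theta> u
  proof -
    note wc = finite_index_congruencesD(1)[OF \<theta>]
    have "\<theta> `` {u} = \<theta> `` {v} \<longleftrightarrow> (u, v) \<in> \<theta>" if "v \<in> F" for v
      using word_congruence_class_eq[OF wc u] subshift_languageD(1)[OF assms] that by blast
    moreover have "\<theta> `` {u @ u} = \<theta> `` {u} \<longleftrightarrow> (u @ u, u) \<in> \<theta>"
      using word_congruence_class_eq[OF wc _ u] u by simp
    ultimately show ?thesis unfolding quotient_monoid_mult[OF wc u u] by blast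
  qed
  have "\<exists>e\<in>carrier (free_profinite_monoid A). \<forall>\<theta>\<in>finite_index_congruences A. ?P \<theta> (e \<theta>)"
  proof (rule profinite_inverse_limit)
    fix \<theta> assume \<theta>: "\<theta> \<in> finite_index_congruences A"
    obtain u where u: "u \<in> lists A" "(u @ u, u) \<in> \<theta>" "\<And>n. \<exists>v\<in>F. n \<le> length v \<and> \<theta> `` {u} = \<theta> `` {v}"
      using subshift_idempotent_class[OF assms \<theta>] by blast
    have "\<theta> `` {u} \<otimes>\<^bsub>quotient_monoid A \<theta>\<^esub> \<theta> `` {u} = \<theta> `` {u}"
      unfolding quotient_monoid_mult[OF finite_index_congruencesD(1)[OF \<theta>] u(1) u(1)]
      using equiv_class_eq[OF word_congruence_equiv[OF finite_index_congruencesD(1)[OF \<theta>]] u(2)] .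
    with u show "\<exists>u\<in>lists A. ?P \<theta> (\<theta> `` {u})" by blast
  next
    fix \<theta> \<rho> u
    assume \<theta>: "\<theta> \<in> finite_index_congruences A" and \<rho>: "\<rho> \<in> finite_index_congruences A"
      and "\<theta> \<subseteq> \<rho>" and u: "u \<in> lists A" and "?P \<theta> (\<theta> `` {u})"
    then have "(u @ u, u) \<in> \<rho> \<and> (\<forall>n. \<exists>v\<in>F. n \<le> length v \<and> (u, v) \<in> \<rho>)"
      unfolding P_iff[OF \<theta> u] by blast
    then show "?P \<rho> (\<rho> `` {u})" unfolding P_iff[OF \<rho> u] .
  qed
  then obtain e where e: "e \<in> carrier (free_profinite_monoid A)"
    "\<forall>\<theta>\<in>finite_index_congruences A. ?P \<theta> (e \<theta>)" by (elim bexE)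
  have "e \<otimes>\<^bsub>free_profinite_monoid A\<^esub> e = e"
  proof (rule profinite_eqI[OF profinite_mult_mem[OF e(1) e(1)] e(1)])
    fix \<theta> assume \<theta>: "\<theta> \<in> finite_index_congruences A"
    then show "(e \<otimes>\<^bsub>free_profinite_monoid A\<^esub> e) \<theta> = e \<theta>"
      unfolding profinite_mult_component[OF \<theta>] using e(2) by blast
  qed
  with e show ?thesis by (intro that) blast+
qed

text \<open>In a finite quotient \<open>x\<close> is represented by a word of \<open>F\<close> and
  \<open>y\<close> by an arbitrarily long one, which contains the former by uniform recurrence.
  Compactness lifts the factorization.\<close>

lemma uniformly_recurrent_factor:
  assumes F: "uniformly_recurrent A F"
    and y: "y \<in> carrier (free_profinite_monoid A)"
    and y_inf: "\<And>\<theta> n. \<theta> \<in> finite_index_congruences A \<Longrightarrow> \<exists>v\<in>F. n \<le> length v \<and> y \<theta> = \<theta> `` {v}"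
    and x: "x \<in> profinite_closure A F"
  obtains p q where "p \<in> carrier (free_profinite_monoid A)" "q \<in> carrier (free_profinite_monoid A)"
    "y = p \<otimes>\<^bsub>free_profinite_monoid A\<^esub> x \<otimes>\<^bsub>free_profinite_monoid A\<^esub> q"
proof -
  let ?C = "carrier (free_profinite_monoid A)" and ?I = "finite_index_congruences A"
  have sub: "F \<subseteq> lists A"
    using F subshift_languageD(1) unfolding uniformly_recurrent_def by blast
  have xC: "x \<in> ?C" and x_word: "\<And>\<theta>. \<theta> \<in> ?I \<Longrightarrow> \<exists>w\<in>F. x \<theta> = \<theta> `` {w}"
    using x profinite_closure_iff[OF sub] by blast+
  let ?eq = "\<lambda>\<theta> c d. y \<theta> = c \<otimes>\<^bsub>quotient_monoid A \<theta>\<^esub> x \<theta> \<otimes>\<^bsub>quotient_monoid A \<theta>\<^esub> d"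
  have eq_mono: "?eq \<rho> (\<rho> `` {u}) (\<rho> `` {v})"
    if \<theta>: "\<theta> \<in> ?I" and \<rho>: "\<rho> \<in> ?I" and le: "\<theta> \<subseteq> \<rho>" and u: "u \<in> lists A" and v: "v \<in> lists A"
      and eq: "?eq \<theta> (\<theta> `` {u}) (\<theta> `` {v})" for \<theta> \<rho> u v
  proof -
    obtain w where w: "w \<in> lists A" "x \<theta> = \<theta> `` {w}" using profinite_componentE[OF xC \<theta>] .
    have "y \<theta> = \<theta> `` {(u @ w) @ v}"
      using eq w(2) quotient_monoid_mult[OF finite_index_congruencesD(1)[OF \<theta>]] u v w(1) by simp
    then have "y \<rho> = \<rho> `` {(u @ w) @ v}"
      using profinite_component_mono[OF y \<theta> \<rho> le] u v w(1) by simp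
    moreover have "x \<rho> = \<rho> `` {w}" using profinite_component_mono[OF xC \<theta> \<rho> le w] .
    ultimately show ?thesis
      using quotient_monoid_mult[OF finite_index_congruencesD(1)[OF \<rho>]] u v w(1) by simp
  qed
  \<comment> \<open>Gluing yields one element at a time: \<open>p\<close> is chosen so that a right
    factor exists at each level, and a second passage to the limit finds \<open>q\<close>.\<close>
  have "\<exists>p\<in>?C. \<forall>\<theta>\<in>?I. \<exists>v\<in>lists A. ?eq \<theta> (p \<theta>) (\<theta> `` {v})"
  proof (rule profinite_inverse_limit)
    fix \<theta> assume \<theta>: "\<theta> \<in> ?I"
    obtain w where w: "w \<in> F" "x \<theta> = \<theta> `` {w}" using x_word[OF \<theta>] by blast
    obtain N where N: "\<forall>v\<in>F. N \<le> length v \<longrightarrow> sublist w v"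
      using F w(1) unfolding uniformly_recurrent_def by blast
    obtain t where t: "t \<in> F" "N \<le> length t" "y \<theta> = \<theta> `` {t}" using y_inf[OF \<theta>] by blast
    with N have "sublist w t" by blast
    then obtain u v where uv: "t = u @ w @ v" unfolding sublist_def by blast
    then have lists: "u \<in> lists A" "w \<in> lists A" "v \<in> lists A" using t(1) sub by auto
    then have "?eq \<theta> (\<theta> `` {u}) (\<theta> `` {v})"
      using t(3) w(2) uv quotient_monoid_mult[OF finite_index_congruencesD(1)[OF \<theta>]] by simp
    with lists show "\<exists>u\<in>lists A. \<exists>v\<in>lists A. ?eq \<theta> (\<theta> `` {u}) (\<theta> `` {v})" by blast
  next
    fix \<theta> \<rho> u
    assume *: "\<theta> \<in> ?I" "\<rho> \<in> ?I" "\<theta> \<subseteq> \<rho>" "u \<in> lists A" and "\<exists>v\<in>lists A. ?eq \<theta> (\<theta> `` {u}) (\<theta> `` {v})"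
    then obtain v where v: "v \<in> lists A" "?eq \<theta> (\<theta> `` {u}) (\<theta> `` {v})" by (elim bexE)
    show "\<exists>v\<in>lists A. ?eq \<rho> (\<rho> `` {u}) (\<rho> `` {v})"
      using eq_mono[OF * v] v(1) by (rule bexI)
  qed
  then obtain p where p: "p \<in> ?C" "\<forall>\<theta>\<in>?I. \<exists>v\<in>lists A. ?eq \<theta> (p \<theta>) (\<theta> `` {v})" by (elim bexE)
  have "\<exists>q\<in>?C. \<forall>\<theta>\<in>?I. ?eq \<theta> (p \<theta>) (q \<theta>)"
  proof (rule profinite_inverse_limit)
    fix \<theta> assume "\<theta> \<in> ?I"
    then show "\<exists>v\<in>lists A. ?eq \<theta> (p \<theta>) (\<theta> `` {v})" by (rule bspec[OF p(2)])
  next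
    fix \<theta> \<rho> v
    assume *: "\<theta> \<in> ?I" "\<rho> \<in> ?I" "\<theta> \<subseteq> \<rho>" and v: "v \<in> lists A" "?eq \<theta> (p \<theta>) (\<theta> `` {v})"
    obtain u where u: "u \<in> lists A" "p \<theta> = \<theta> `` {u}" using profinite_componentE[OF p(1) *(1)] .
    have "p \<rho> = \<rho> `` {u}" using profinite_component_mono[OF p(1) * u] .
    then show "?eq \<rho> (p \<rho>) (\<rho> `` {v})"
      using eq_mono[OF * u(1) v(1)] v(2) u(2) by simp
  qed
  then obtain q where q: "q \<in> ?C" "\<forall>\<theta>\<in>?I. ?eq \<theta> (p \<theta>) (q \<theta>)" by (elim bexE)
  have "y = p \<otimes>\<^bsub>free_profinite_monoid A\<^esub> x \<otimes>\<^bsub>free_profinite_monoid A\<^esub> q"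
  proof (rule profinite_eqI[OF y])
    fix \<theta> assume \<theta>: "\<theta> \<in> ?I"
    then show "y \<theta> = (p \<otimes>\<^bsub>free_profinite_monoid A\<^esub> x \<otimes>\<^bsub>free_profinite_monoid A\<^esub> q) \<theta>"
      unfolding profinite_mult_component[OF \<theta>] by (rule bspec[OF q(2)])
  qed (intro profinite_mult_mem p(1) xC q(1))
  with p(1) q(1) show ?thesis by (rule that)
qed

text \<open>Factoriality passes to the closure because multiplication is open: a word of
  \<open>F\<close> near \<open>x y\<close> splits into parts near \<open>x\<close> and
  \<open>y\<close>.\<close>

lemma profinite_closure_prefix:
  assumes F: "subshift_language A F"
    and x: "x \<in> carrier (free_profinite_monoid A)" and y: "y \<in> carrier (free_profinite_monoid A)"
    and xy: "x \<otimes>\<^bsub>free_profinite_monoid A\<^esub> y \<in> profinite_closure A F"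
  shows "x \<in> profinite_closure A F"
proof -
  have sub: "F \<subseteq> lists A" using subshift_languageD(1)[OF F] .
  have "\<exists>u\<in>F. x \<theta> = \<theta> `` {u}" if \<theta>: "\<theta> \<in> finite_index_congruences A" for \<theta>
  proof -
    obtain \<rho> where \<rho>: "\<rho> \<in> finite_index_congruences A" "\<rho> \<subseteq> \<theta>"
      "\<forall>t u v. (t, u @ v) \<in> \<rho> \<longrightarrow> (\<exists>u' v'. t = u' @ v' \<and> (u', u) \<in> \<theta> \<and> (v', v) \<in> \<theta>)"
      using split_congruence[OF \<theta>] .
    note wc = finite_index_congruencesD(1)[OF \<rho>(1)]
    obtain t where t: "t \<in> F" "(x \<otimes>\<^bsub>free_profinite_monoid A\<^esub> y) \<rho> = \<rho> `` {t}"
      using xy \<rho>(1) unfolding profinite_closure_iff[OF sub] by blast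
    obtain a where a: "a \<in> lists A" "x \<rho> = \<rho> `` {a}" using profinite_componentE[OF x \<rho>(1)] .
    obtain b where b: "b \<in> lists A" "y \<rho> = \<rho> `` {b}" using profinite_componentE[OF y \<rho>(1)] .
    have "\<rho> `` {t} = \<rho> `` {a @ b}"
      using t(2) a b quotient_monoid_mult[OF wc a(1) b(1)]
      by (simp add: profinite_mult_component[OF \<rho>(1)])
    then have "(t, a @ b) \<in> \<rho>"
      using word_congruence_class_eq[OF wc, of t "a @ b"] t(1) a(1) b(1) sub by auto
    with \<rho>(3) obtain a' b' where ab: "t = a' @ b'" "(a', a) \<in> \<theta>" by blast
    then have "sublist a' t" by simp
    then have "a' \<in> F" using subshift_languageD(3)[OF F t(1)] by blast
    moreover have "x \<theta> = \<theta> `` {a'}"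
      using profinite_component_mono[OF x \<rho>(1) \<theta> \<rho>(2) a]
        equiv_class_eq[OF word_congruence_equiv[OF finite_index_congruencesD(1)[OF \<theta>]] ab(2)] by simp
    ultimately show ?thesis by blast
  qed
  with x show ?thesis unfolding profinite_closure_iff[OF sub] by blast
qed

text \<open>If e = k s, then \<open>k\<close> is a left factor of an element of the closure; if k =
  e t, then \<open>k\<close> inherits from \<open>e\<close> that it is J-below the whole closure.
  Thus the charge condition applies to the maximal subgroup at \<open>e\<close>.\<close>

lemma J_class_contains_H_class:
  assumes F: "uniformly_recurrent A F"
    and e: "e \<in> carrier (free_profinite_monoid A)"
    and e_inf: "\<And>\<theta> n. \<theta> \<in> finite_index_congruences A \<Longrightarrow> \<exists>v\<in>F. n \<le> length v \<and> e \<theta> = \<theta> `` {v}"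
  shows "H_rel (free_profinite_monoid A) `` {e} \<subseteq> J_class_of_language A F"
proof
  interpret P: monoid "free_profinite_monoid A" by (rule free_profinite_monoid_monoid)
  have subshift: "subshift_language A F" using F by (simp add: uniformly_recurrent_def)
  have e_closure: "e \<in> profinite_closure A F"
    unfolding profinite_closure_iff[OF subshift_languageD(1)[OF subshift]] using e e_inf by blast
  fix k assume "k \<in> H_rel (free_profinite_monoid A) `` {e}"
  then have "k \<in> carrier (free_profinite_monoid A)" "R_le (free_profinite_monoid A) k e"
    "R_le (free_profinite_monoid A) e k"
    by (auto simp: H_rel_def R_rel_def)
  then obtain s t where k: "k \<in> carrier (free_profinite_monoid A)"
    and s: "s \<in> carrier (free_profinite_monoid A)" "e = k \<otimes>\<^bsub>free_profinite_monoid A\<^esub> s"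
    and t: "t \<in> carrier (free_profinite_monoid A)" "k = e \<otimes>\<^bsub>free_profinite_monoid A\<^esub> t"
    unfolding R_le_def by blast
  have "k \<in> profinite_closure A F"
    using profinite_closure_prefix[OF subshift k s(1)] s(2) e_closure by simp
  moreover have "J_le (free_profinite_monoid A) k y" if y: "y \<in> profinite_closure A F" for y
  proof -
    have yC: "y \<in> carrier (free_profinite_monoid A)"
      using y unfolding profinite_closure_iff[OF subshift_languageD(1)[OF subshift]] by blast
    obtain p q where pq: "p \<in> carrier (free_profinite_monoid A)" "q \<in> carrier (free_profinite_monoid A)"
      "e = p \<otimes>\<^bsub>free_profinite_monoid A\<^esub> y \<otimes>\<^bsub>free_profinite_monoid A\<^esub> q"
      using uniformly_recurrent_factor[OF F e e_inf y] .
    have "k = p \<otimes>\<^bsub>free_profinite_monoid A\<^esub> y \<otimes>\<^bsub>free_profinite_monoid A\<^esub> (q \<otimes>\<^bsub>free_profinite_monoid A\<^esub> t)"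
      using t pq yC P.m_assoc by simp
    with pq t(1) show ?thesis unfolding J_le_def by blast
  qed
  ultimately show "k \<in> J_class_of_language A F"
    unfolding J_class_of_language_def by blast
qed

section \<open>Decoding by a charged code\<close>

text \<open>The substance is prolongability over \<open>X\<close>: extend within \<open>F\<close>
  past the longest code word, cover the result by a product of code words, and cancel the given
  part. The adjacent code word lies inside the extension, hence in \<open>F\<close> together with
  the given part.\<close>

lemma decoding_subshift:
  assumes F: "subshift_language A F" and X: "finite X" "[] \<notin> X" "covers X F"
    and prefix: "\<forall>x\<in>X. \<forall>y\<in>X. \<not> strict_prefix x y"
    and suffix: "\<forall>x\<in>X. \<forall>y\<in>X. \<not> strict_suffix x y"
  shows "subshift_language X (decoding X F)"
  unfolding subshift_language_def
proof (intro conjI ballI allI impI)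
  show "decoding X F \<subseteq> lists X" unfolding decoding_def by blast
  have "[] \<in> decoding X F" using subshift_languageD(2)[OF F] by (simp add: decoding_def)
  then show "decoding X F \<noteq> {}" by blast
next
  fix ws us assume ws: "ws \<in> decoding X F" and "sublist us ws"
  then obtain ps ss where "ws = ps @ us @ ss" unfolding sublist_def by (elim exE)
  with ws have "us \<in> lists X" "concat ws \<in> F" "concat ws = concat ps @ concat us @ concat ss"
    by (auto simp: decoding_def)
  then have "sublist (concat us) (concat ws)" by (metis sublist_appendI)
  with \<open>us \<in> lists X\<close> \<open>concat ws \<in> F\<close> show "us \<in> decoding X F"
    using subshift_languageD(3)[OF F] by (simp add: decoding_def)
next
  fix us assume "us \<in> decoding X F"
  then have us: "us \<in> lists X" "concat us \<in> F" by (auto simp: decoding_def)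
  \<comment> \<open>A strict bound on code word lengths; an extension of length \<open>Suc m\<close>
    is nonempty and contains the next code word entirely.\<close>
  obtain m where m: "\<And>x. x \<in> X \<Longrightarrow> length x < m"
    using finite_imageI[OF X(1), of length] unfolding finite_nat_set_iff_bounded by blast
  have "\<exists>b\<in>X. us @ [b] \<in> decoding X F"
  proof -
    obtain v where v: "length v = Suc m" "concat us @ v \<in> F"
      using subshift_extend_right[OF F us(2)] by blast
    obtain w where w: "w \<in> generated_submonoid X" "prefix (concat us @ v) w"
      using X(3) v(2) unfolding covers_def by blast
    obtain ws where ws: "ws \<in> lists X" "w = concat ws" using w(1) by (rule generated_submonoidE)
    obtain t where t: "w = (concat us @ v) @ t" using w(2) by (rule prefixE)
    have "concat us @ (v @ t) = concat ws" using ws(2) t by simp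
    from prefix_code_parse[OF X(2) prefix us(1) ws(1) this] obtain vs
      where vs: "ws = us @ vs" "v @ t = concat vs" by (elim exE conjE)
    have "vs \<noteq> []" using vs(2) v(1) by auto
    then obtain x xs where "vs = x # xs" by (cases vs) auto
    then have x: "x \<in> X" using ws(1) vs(1) by simp
    have "v @ t = x @ concat xs" using vs(2) \<open>vs = x # xs\<close> by simp
    moreover have "length x \<le> length v" using m[OF x] v(1) by simp
    ultimately obtain s where "v = x @ s"
      by (metis prefixE prefixI prefix_length_prefix)
    then have "sublist (concat us @ x) (concat us @ v)" by simp
    then have "concat us @ x \<in> F" using subshift_languageD(3)[OF F v(2)] by blast
    with us(1) x show ?thesis by (intro bexI[OF _ x]) (simp add: decoding_def)
  qed
  moreover have "\<exists>a\<in>X. a # us \<in> decoding X F"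
  proof -
    obtain v where v: "length v = Suc m" "v @ concat us \<in> F"
      using subshift_extend_left[OF F us(2)] by blast
    obtain w where w: "w \<in> generated_submonoid X" "suffix (v @ concat us) w"
      using X(3) v(2) unfolding covers_def by blast
    obtain ws where ws: "ws \<in> lists X" "w = concat ws" using w(1) by (rule generated_submonoidE)
    obtain t where t: "w = t @ (v @ concat us)" using w(2) by (rule suffixE)
    have "(t @ v) @ concat us = concat ws" using ws(2) t by simp
    from suffix_code_parse[OF X(2) suffix us(1) ws(1) this] obtain vs
      where vs: "ws = vs @ us" "t @ v = concat vs" by (elim exE conjE)
    have "vs \<noteq> []" using vs(2) v(1) by auto
    then obtain xs x where "vs = xs @ [x]" by (cases vs rule: rev_cases) auto
    then have x: "x \<in> X" using ws(1) vs(1) by simp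
    have "t @ v = concat xs @ x" using vs(2) \<open>vs = xs @ [x]\<close> by simp
    moreover have "length x \<le> length v" using m[OF x] v(1) by simp
    ultimately obtain s where "v = s @ x"
      by (metis suffixE suffixI suffix_length_suffix)
    then have "v @ concat us = s @ (x @ concat us) @ []" by simp
    then have "sublist (x @ concat us) (v @ concat us)" unfolding sublist_def by blast
    then have "x @ concat us \<in> F" using subshift_languageD(3)[OF F v(2)] by blast
    with us(1) x show ?thesis by (intro bexI[OF _ x]) (simp add: decoding_def)
  qed
  ultimately show "\<exists>a\<in>X. \<exists>b\<in>X. a # us \<in> decoding X F \<and> us @ [b] \<in> decoding X F" by blast
qed

text \<open>Transfers a length bound over \<open>A\<close> to lengths over the alphabet
  \<open>X\<close>.\<close>

lemma length_concat_ge: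
  assumes "[] \<notin> set ws"
  shows "length ws \<le> length (concat ws)"
  using assms
proof (induction ws)
  case (Cons w ws)
  then have "1 \<le> length w" by (cases w) auto
  with Cons show ?case by simp
qed simp

text \<open>\<open>T\<close> does not depend on \<open>a\<close>; only the position of
  \<open>w\<close> inside \<open>T\<close> does.\<close>

lemma charged_idempotent_positions:
  assumes F: "uniformly_recurrent A F" and Z: "charged_code A F Z" and w: "w \<in> F"
  obtains T where "T \<in> F"
    "\<And>a. a \<in> lists A \<Longrightarrow> \<exists>u v. T = u @ w @ v \<and> a @ u \<in> generated_submonoid Z"
proof -
  let ?L = "generated_submonoid Z" and ?P = "free_profinite_monoid A"
  let ?\<theta> = "syntactic_congruence A ?L" and ?w = "profinite_word A w"
  let ?M = "syntactic_monoid A ?L"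
  have subshift: "subshift_language A F" using F by (simp add: uniformly_recurrent_def)
  have sub: "F \<subseteq> lists A" by (rule subshift_languageD(1)[OF subshift])
  have w_lists: "w \<in> lists A" using w sub by blast
  have code: "rational A Z" "bifix_code A Z" "complete_code A Z"
    using Z unfolding charged_code_def by blast+
  have \<theta>: "?\<theta> \<in> finite_index_congruences A"
    by (rule syntactic_congruence_finite_index[OF rational.star[OF code(1)]])
  note \<theta>_wc = finite_index_congruencesD(1)[OF \<theta>]
  have M: "?M = quotient_monoid A ?\<theta>" by (simp add: syntactic_monoid_def)
  interpret P: monoid ?P by (rule free_profinite_monoid_monoid)
  interpret M: monoid ?M unfolding M by (rule quotient_monoid_monoid[OF \<theta>_wc])
  have M_fin: "finite (carrier ?M)" using finite_index_congruencesD(2)[OF \<theta>] by (simp add: M)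
  have M_mem: "x ?\<theta> \<in> carrier ?M" if "x \<in> carrier ?P" for x
    using profinite_component[OF that \<theta>] by (simp add: M)
  have M_mult: "(x \<otimes>\<^bsub>?P\<^esub> y) ?\<theta> = x ?\<theta> \<otimes>\<^bsub>?M\<^esub> y ?\<theta>" for x y
    unfolding M by (rule profinite_mult_component[OF \<theta>])

  obtain e where e: "e \<in> carrier ?P" "e \<otimes>\<^bsub>?P\<^esub> e = e"
    and e_inf: "\<And>\<theta> n. \<theta> \<in> finite_index_congruences A \<Longrightarrow> \<exists>v\<in>F. n \<le> length v \<and> e \<theta> = \<theta> `` {v}"
    using subshift_infinite_idempotent[OF subshift] by blast
  let ?K = "H_rel ?P `` {e}"
  have eK: "e \<in> ?K" using P.H_rel_refl[OF e(1)] by blast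
  have "maximal_subgroup ?P ?K"
    unfolding maximal_subgroup_def using quotientI[OF e(1)] eK e(2) by blast
  moreover have "?K \<subseteq> J_class_of_language A F" by (rule J_class_contains_H_class[OF F e(1) e_inf])
  ultimately have charged: "maximal_subgroup ?M (syntactic_ext A ?L ` ?K)"
    "syntactic_ext A ?L ` ?K \<subseteq> minimum_ideal ?M"
    using Z unfolding charged_code_def by blast+
  have ext: "syntactic_ext A ?L x = x ?\<theta>" if "x \<in> carrier ?P" for x
    by (rule syntactic_ext_component[OF \<theta> that])
  have e\<theta>: "e ?\<theta> \<in> syntactic_ext A ?L ` ?K"
    using imageI[OF eK, of "syntactic_ext A ?L"] unfolding ext[OF e(1)] .
  have e\<theta>_idem: "e ?\<theta> \<otimes>\<^bsub>?M\<^esub> e ?\<theta> = e ?\<theta>" using M_mult[of e e] e(2) by simp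

  have "?w \<in> profinite_closure A F"
    unfolding profinite_closure_iff[OF sub]
    using profinite_word_mem[OF w_lists] profinite_word_component w by blast
  then obtain p q where pq: "p \<in> carrier ?P" "q \<in> carrier ?P" "e = p \<otimes>\<^bsub>?P\<^esub> ?w \<otimes>\<^bsub>?P\<^esub> q"
    using uniformly_recurrent_factor[OF F e(1) e_inf] by blast
  \<comment> \<open>Multiplying \<open>p\<close> by \<open>e\<close> makes \<open>e\<close> a left
    identity of \<open>?r\<close>, as the choice of \<open>h\<close> below requires.\<close>
  let ?r = "e \<otimes>\<^bsub>?P\<^esub> p"
  have r: "?r \<in> carrier ?P" using e(1) pq(1) by simp
  have "e \<otimes>\<^bsub>?P\<^esub> ?r = ?r" using P.m_assoc[OF e(1) e(1) pq(1)] e(2) by simp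
  then have er: "e ?\<theta> \<otimes>\<^bsub>?M\<^esub> ?r ?\<theta> = ?r ?\<theta>" using M_mult[of e ?r] by simp

  \<comment> \<open>Modulo the second congruence the class of \<open>w\<close> is {w}, so a middle
    factor congruent to \<open>w\<close> is literally \<open>w\<close>.\<close>
  let ?\<theta>1 = "?\<theta> \<inter> syntactic_congruence A {w}"
  have "rational A {w}" using w_lists by (intro rational.finite) auto
  then have \<theta>1: "?\<theta>1 \<in> finite_index_congruences A"
    by (intro finite_index_congruences_Int \<theta> syntactic_congruence_finite_index)
  have w_class: "w' = w" if "(w', w) \<in> ?\<theta>1" for w'
  proof -
    have "[] @ w' @ [] \<in> {w} \<longleftrightarrow> [] @ w @ [] \<in> {w}"
      using that unfolding syntactic_congruence_def by blast
    then show ?thesis by simp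
  qed
  \<comment> \<open>Three factors require two cuts: \<open>\<rho>\<close> detaches the left factor,
    \<open>\<rho>1\<close> then separates \<open>w\<close> from the rest.\<close>
  obtain \<rho>1 where \<rho>1: "\<rho>1 \<in> finite_index_congruences A" "\<rho>1 \<subseteq> ?\<theta>1"
    "\<forall>t u v. (t, u @ v) \<in> \<rho>1 \<longrightarrow> (\<exists>u' v'. t = u' @ v' \<and> (u', u) \<in> ?\<theta>1 \<and> (v', v) \<in> ?\<theta>1)"
    using split_congruence[OF \<theta>1] .
  obtain \<rho> where \<rho>: "\<rho> \<in> finite_index_congruences A" "\<rho> \<subseteq> \<rho>1"
    "\<forall>t u v. (t, u @ v) \<in> \<rho> \<longrightarrow> (\<exists>u' v'. t = u' @ v' \<and> (u', u) \<in> \<rho>1 \<and> (v', v) \<in> \<rho>1)"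
    using split_congruence[OF \<rho>1(1)] .
  note \<rho>_wc = finite_index_congruencesD(1)[OF \<rho>(1)]
  have \<rho>\<theta>: "\<rho> \<subseteq> ?\<theta>" using \<rho>(2) \<rho>1(2) by blast
  obtain T where T: "T \<in> F" "e \<rho> = \<rho> `` {T}" using e_inf[OF \<rho>(1)] by blast
  have T_lists: "T \<in> lists A" using T(1) sub by blast

  text \<open>For \<open>k \<in> K\<close> the factorization \<open>e = (k e p) w (q s)\<close>, where \<open>e = k s\<close>, is inherited by \<open>T\<close>.\<close>

  have T_split: "\<exists>u v. u \<in> lists A \<and> T = u @ w @ v \<and> ?\<theta> `` {u} = k ?\<theta> \<otimes>\<^bsub>?M\<^esub> ?r ?\<theta>" if kK: "k \<in> ?K" for k
  proof -
    have "k \<in> carrier ?P" "R_le ?P e k" "L_le ?P k e"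
      using kK by (auto simp: H_rel_def R_rel_def L_rel_def)
    then obtain s t where k: "k \<in> carrier ?P" and s: "s \<in> carrier ?P" "e = k \<otimes>\<^bsub>?P\<^esub> s"
      and t: "t \<in> carrier ?P" "k = t \<otimes>\<^bsub>?P\<^esub> e"
      unfolding R_le_def L_le_def by blast
    have wP: "?w \<in> carrier ?P" by (rule profinite_word_mem[OF w_lists])
    have "k \<otimes>\<^bsub>?P\<^esub> e = k" using t e P.m_assoc[OF t(1) e(1) e(1)] by simp
    \<comment> \<open>Of the two copies of \<open>e\<close>, one stays in front of \<open>p\<close>
      and the other is expanded as p w q.\<close>
    then have "e = (k \<otimes>\<^bsub>?P\<^esub> (e \<otimes>\<^bsub>?P\<^esub> e)) \<otimes>\<^bsub>?P\<^esub> s" using s(2) e(2) by simp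
    also have "\<dots> = (k \<otimes>\<^bsub>?P\<^esub> (e \<otimes>\<^bsub>?P\<^esub> (p \<otimes>\<^bsub>?P\<^esub> ?w \<otimes>\<^bsub>?P\<^esub> q))) \<otimes>\<^bsub>?P\<^esub> s" using pq(3) by simp
    also have "\<dots> = (k \<otimes>\<^bsub>?P\<^esub> ?r) \<otimes>\<^bsub>?P\<^esub> (?w \<otimes>\<^bsub>?P\<^esub> (q \<otimes>\<^bsub>?P\<^esub> s))"
      using k e(1) pq(1,2) wP s(1) by (simp add: P.m_assoc)
    finally have fact: "e = (k \<otimes>\<^bsub>?P\<^esub> ?r) \<otimes>\<^bsub>?P\<^esub> (?w \<otimes>\<^bsub>?P\<^esub> (q \<otimes>\<^bsub>?P\<^esub> s))" .
    have kr: "k \<otimes>\<^bsub>?P\<^esub> ?r \<in> carrier ?P" using k r by simp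
    obtain a where a: "a \<in> lists A" "(k \<otimes>\<^bsub>?P\<^esub> ?r) \<rho> = \<rho> `` {a}" using profinite_componentE[OF kr \<rho>(1)] .
    obtain c where c: "c \<in> lists A" "(q \<otimes>\<^bsub>?P\<^esub> s) \<rho> = \<rho> `` {c}"
      using profinite_componentE[OF P.m_closed[OF pq(2) s(1)] \<rho>(1)] .
    have wc: "w @ c \<in> lists A" using w_lists c(1) by simp
    have "e \<rho> = \<rho> `` {a} \<otimes>\<^bsub>quotient_monoid A \<rho>\<^esub> (\<rho> `` {w} \<otimes>\<^bsub>quotient_monoid A \<rho>\<^esub> \<rho> `` {c})"
      by (subst fact) (simp only: profinite_mult_component[OF \<rho>(1), of "k \<otimes>\<^bsub>?P\<^esub> ?r"]
          profinite_mult_component[OF \<rho>(1), of ?w] profinite_word_component[OF \<rho>(1)] a(2) c(2))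
    then have "\<rho> `` {T} = \<rho> `` {a @ (w @ c)}"
      unfolding T(2) quotient_monoid_mult[OF \<rho>_wc w_lists c(1)] quotient_monoid_mult[OF \<rho>_wc a(1) wc] .
    then have "(T, a @ (w @ c)) \<in> \<rho>"
      using word_congruence_class_eq[OF \<rho>_wc T_lists, of "a @ (w @ c)"] a(1) wc by simp
    with \<rho>(3) obtain u v where uv: "T = u @ v" "(u, a) \<in> \<rho>1" "(v, w @ c) \<in> \<rho>1" by blast
    with \<rho>1(3) obtain w' v' where wv: "v = w' @ v'" "(w', w) \<in> ?\<theta>1" by blast
    have "(u, a) \<in> ?\<theta>" using uv(2) \<rho>1(2) by blast
    then have "?\<theta> `` {u} = ?\<theta> `` {a}" by (rule equiv_class_eq[OF word_congruence_equiv[OF \<theta>_wc]])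
    also have "\<dots> = (k \<otimes>\<^bsub>?P\<^esub> ?r) ?\<theta>" using profinite_component_mono[OF kr \<rho>(1) \<theta> \<rho>\<theta> a] by (rule sym)
    also have "\<dots> = k ?\<theta> \<otimes>\<^bsub>?M\<^esub> ?r ?\<theta>" by (rule M_mult)
    finally have "?\<theta> `` {u} = k ?\<theta> \<otimes>\<^bsub>?M\<^esub> ?r ?\<theta>" .
    moreover have "T = u @ w @ v'" using uv(1) wv(1) w_class[OF wv(2)] by simp
    moreover have "u \<in> lists A" using T_lists uv(1) by simp
    ultimately show ?thesis by blast
  qed

  have "\<exists>u v. T = u @ w @ v \<and> a @ u \<in> ?L" if a: "a \<in> lists A" for a
  proof -
    have a\<theta>: "?\<theta> `` {a} \<in> carrier ?M" using a by (simp add: M quotientI)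
    obtain h where h: "(e ?\<theta>, h) \<in> H_rel ?M"
      "(?\<theta> `` {a} \<otimes>\<^bsub>?M\<^esub> h \<otimes>\<^bsub>?M\<^esub> ?r ?\<theta>) \<otimes>\<^bsub>?M\<^esub> (?\<theta> `` {a} \<otimes>\<^bsub>?M\<^esub> h \<otimes>\<^bsub>?M\<^esub> ?r ?\<theta>)
        = ?\<theta> `` {a} \<otimes>\<^bsub>?M\<^esub> h \<otimes>\<^bsub>?M\<^esub> ?r ?\<theta>"
      using M.minimum_ideal_H_class_idempotent[OF M_fin subsetD[OF charged(2) e\<theta>] M_mem[OF e(1)]
          e\<theta>_idem a\<theta> M_mem[OF r] er] .
    \<comment> \<open>The image of \<open>K\<close> is an entire H-class, so the correcting element
      \<open>h\<close> is the image of some \<open>k\<close>.\<close>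
    have "h \<in> syntactic_ext A ?L ` ?K" by (rule M.maximal_subgroup_H_class[OF charged(1) e\<theta> h(1)])
    then obtain k where k: "k \<in> ?K" "h = syntactic_ext A ?L k" by (rule imageE)
    have kP: "k \<in> carrier ?P" using k(1) by (auto simp: H_rel_def R_rel_def)
    have hk: "h = k ?\<theta>" using k(2) ext[OF kP] by simp
    obtain u v where uv: "u \<in> lists A" "T = u @ w @ v" "?\<theta> `` {u} = k ?\<theta> \<otimes>\<^bsub>?M\<^esub> ?r ?\<theta>"
      using T_split[OF k(1)] by (elim exE conjE)
    have au: "a @ u \<in> lists A" using a uv(1) by simp
    have "?\<theta> `` {a} \<otimes>\<^bsub>?M\<^esub> h \<otimes>\<^bsub>?M\<^esub> ?r ?\<theta> = ?\<theta> `` {a} \<otimes>\<^bsub>?M\<^esub> ?\<theta> `` {u}"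
      unfolding hk uv(3) by (rule M.m_assoc[OF a\<theta> M_mem[OF kP] M_mem[OF r]])
    also have "\<dots> = ?\<theta> `` {a @ u}" unfolding M by (rule quotient_monoid_mult[OF \<theta>_wc a uv(1)])
    finally have eq: "?\<theta> `` {a} \<otimes>\<^bsub>?M\<^esub> h \<otimes>\<^bsub>?M\<^esub> ?r ?\<theta> = ?\<theta> `` {a @ u}" .
    have "?\<theta> `` {(a @ u) @ (a @ u)} = ?\<theta> `` {a @ u}"
      using h(2) unfolding eq unfolding M quotient_monoid_mult[OF \<theta>_wc au au] .
    then have "((a @ u) @ (a @ u), a @ u) \<in> ?\<theta>"
      using word_congruence_class_eq[OF \<theta>_wc _ au, of "(a @ u) @ (a @ u)"] au by simp
    then have "a @ u \<in> ?L" by (rule idempotent_class_in_submonoid[OF code au])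
    with uv(2) show ?thesis by (intro exI conjI)
  qed
  with T(1) show ?thesis by (rule that)
qed

text \<open>Prolongability comes from finiteness of \<open>X\<close> and F-completeness; the return
  of factors comes from the charge, the bound for \<open>ws\<close> being the recurrence bound of
  \<open>T\<close> in \<open>F\<close>.\<close>

theorem theorem4p5:
  fixes A :: "'a set" and F X :: "'a list set"
  assumes "finite A" and "A \<noteq> {}"
    and "uniformly_recurrent A F"
    and "finite X"
    and "F_complete_charged_code A F X"
  shows "uniformly_recurrent X (decoding X F)"
proof -
  obtain Z where Z: "charged_code A F Z" "X = Z \<inter> F"
    using assms(5) unfolding F_complete_charged_code_def by blast
  have "bifix_code A Z" using Z(1) unfolding charged_code_def by blast
  note bifix = bifix_codeD[OF this]
  have XZ: "X \<subseteq> Z" using Z(2) by blast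
  have X_Nil: "[] \<notin> X" using XZ bifix(1) by blast
  have subshift: "subshift_language A F"
    using assms(3) unfolding uniformly_recurrent_def by blast
  have covers: "covers X F"
    using assms(5) unfolding F_complete_charged_code_def F_complete_code_def by blast
  have "subshift_language X (decoding X F)"
  proof (rule decoding_subshift[OF subshift assms(4) X_Nil covers])
    show "\<forall>x\<in>X. \<forall>y\<in>X. \<not> strict_prefix x y" "\<forall>x\<in>X. \<forall>y\<in>X. \<not> strict_suffix x y"
      using bifix(3,4) XZ by blast+
  qed
  moreover have "\<exists>N. \<forall>us\<in>decoding X F. N \<le> length us \<longrightarrow> sublist ws us" if ws: "ws \<in> decoding X F" for ws
  proof -
    have ws': "ws \<in> lists Z" "concat ws \<in> F"
      using ws XZ unfolding decoding_def by auto
    obtain T where T: "T \<in> F" and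
      T_split: "\<And>a. a \<in> lists A \<Longrightarrow> \<exists>u v. T = u @ concat ws @ v \<and> a @ u \<in> generated_submonoid Z"
      using charged_idempotent_positions[OF assms(3) Z(1) ws'(2)] by blast
    obtain N where N: "\<forall>t\<in>F. N \<le> length t \<longrightarrow> sublist T t"
      using assms(3) T unfolding uniformly_recurrent_def by blast
    have "sublist ws us" if us: "us \<in> decoding X F" "N \<le> length us" for us
    proof -
      have us': "us \<in> lists Z" "concat us \<in> F" "[] \<notin> set us"
        using us(1) XZ X_Nil unfolding decoding_def by auto
      have "N \<le> length (concat us)" using us(2) length_concat_ge[OF us'(3)] by simp
      then have "sublist T (concat us)" using N us'(2) by blast
      then obtain a b where ab: "concat us = a @ T @ b" unfolding sublist_def by (elim exE)
      then have "a \<in> lists A" using subshift_languageD(1)[OF subshift] us'(2) by auto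
      \<comment> \<open>The word \<open>a\<close> preceding \<open>T\<close> may end in the middle
        of a code word; the cut of \<open>T\<close> is chosen to suit it.\<close>
      from T_split[OF this] obtain u v
        where uv: "T = u @ concat ws @ v" "a @ u \<in> generated_submonoid Z" by (elim exE conjE)
      obtain as where as: "as \<in> lists Z" "a @ u = concat as" using uv(2) by (rule generated_submonoidE)
      \<comment> \<open>Parsing takes place over \<open>Z\<close>, where \<open>a @ u\<close> is
        known to factor; \<open>us\<close> and \<open>ws\<close> are lists over \<open>Z\<close> as
        well. Cancelling \<open>as\<close> and then \<open>ws\<close> exhibits \<open>ws\<close> as
        a block of \<open>us\<close>.\<close>
      have "concat as @ (concat ws @ v @ b) = concat us" using ab uv(1) as(2)[symmetric] by simp
      from prefix_code_parse[OF bifix(1,3) as(1) us'(1) this] obtain bs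
        where bs: "us = as @ bs" "concat ws @ (v @ b) = concat bs" by (elim exE conjE) simp
      have "bs \<in> lists Z" using us'(1) bs(1) by simp
      from prefix_code_parse[OF bifix(1,3) ws'(1) this bs(2)] obtain cs
        where "bs = ws @ cs" by (elim exE conjE)
      then show ?thesis using bs(1) by simp
    qed
    then show ?thesis by blast
  qed
  ultimately show ?thesis unfolding uniformly_recurrent_def by blast
qed

end
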